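(* For every $\varepsilon>0$, if Algorithm Samp is run with $C=\lceil\frac{6}{e\pi^2\varepsilon}\rceil$, then it is $(\frac1q-\varepsilon)$-competitive, i.e. $\mathbb{E}[\mathsf{ALG}]\ge(\frac1q-\varepsilon)\,\mathbb{E}[\mathsf{OPT}(V_1,\ldots,V_T)]$ for all $T\ge1$ and all independent valuation distributions $\mathbf{v}_1,\ldots,\mathbf{v}_T$, and its running time is polynomial in $\frac1\varepsilon$, $k$, $T$ and $m$.
   Context: Setting (single-item dynamic pricing, public pricing, stochastic valuations). Fix $m\ge1$, prices $0<r^{(1)}<\cdots<r^{(m)}$, $r^{(0)}=0$, $r^{(m+1)}=\infty$, inventory $k\ge1$. Customer $t=1,\ldots,T$ ($T$ unknown) has valuation $V_t\in\{r^{(0)},\ldots,r^{(m)}\}$ drawn independently from a distribution $\mathbf{v}_t$. A public pricing algorithm chooses a (possibly random) price $P_t\in\{r^{(1)},\ldots,r^{(m+1)}\}$ before seeing anything about customer $t$, then learns $\mathbf{v}_t$ and whether a sale ($V_t\ge P_t$) occurred; it must set $P_t=\infty$ when out of inventory. $\mathsf{ALG}=\sum_tP_t\mathbb{1}(V_t\ge P_t)$; $\mathsf{OPT}(V_1,\ldots,V_T)$ is the sum of the $\min\{k,T\}$ largest valuations; expectations are over valuations and algorithmic randomness. Let $q^{(j)}=1-r^{(j-1)}/r^{(j)}$, $q=\sum_{j=1}^mq^{(j)}$. Algorithm VT: initialize $\mathtt{level}[i]=0$, $\mathtt{sold}[i]=\mathtt{false}$ for $i=1,\ldots,k$. For each customer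 $t$: let $i^*_t$ minimize $\mathtt{level}[i]$ (fixed deterministic tie-breaking), and $\ell_t$ satisfy $\mathtt{level}[i^*_t]=r^{(\ell_t)}$. If $\mathtt{sold}[i^*_t]=\mathtt{false}$, choose price $r^{(j)}$, $j\in\{\ell_t+1,\ldots,m\}$, w.p. $q^{(j)}/\sum_{j'=\ell_t+1}^mq^{(j')}$; else price $\infty$. Then observe $V_t,X_t$, set $\mathtt{level}[i^*_t]=\max\{\mathtt{level}[i^*_t],V_t\}$, and if $X_t=1$ set $\mathtt{sold}[i^*_t]=\mathtt{true}$. Algorithm Samp (with positive integer parameter $C$): maintain the current inventory. At each time $t$, repeat up to $C(k+1)t^2$ times: simulate Algorithm VT to the start of time $t$ with fresh independent valuations $V_1,\ldots,V_{t-1}$ drawn from $\mathbf{v}_1,\ldots,\mathbf{v}_{t-1}$ and fresh randomness; if the simulated remaining inventory at the end of time $t-1$ equals the current actual inventory, choose the price for customer $t$ from the distribution that Algorithm VT on this simulated run would use at time $t$, observe $\mathbf{v}_t$ and the purchase decision, update inventory, and move to time $t+1$. If all attempts fail, choose price $\infty$ and move to time $t+1$. *)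

theory Defs
  imports "HOL-Probability.Probability" "HOL-Library.Monad_Syntax"
begin

section \<open>Randomized computations with a step counter\<close>

text \<open>
  The cost model is a randomized real-number random access machine: an arithmetic operation, a
  comparison or an array access costs one step, and drawing from an explicitly tabulated finite
  distribution costs as many steps as the table has entries. Costs are charged by \<open>tick\<close> and
  \<open>sample\<close>; a loop that is written as a closed expression (such as a minimum over \<open>k\<close> array entries)
  is preceded by a \<open>tick\<close> for its iterations.
\<close>

datatype 'a timed = Timed (timed_pmf: "('a \<times> nat) pmf")

definition ret :: "'a \<Rightarrow> 'a timed" where
  "ret x = Timed (return_pmf (x, 0))"

definition tick :: "nat \<Rightarrow> unit timed" where
  "tick n = Timed (return_pmf ((), n))"

definition sample :: "nat \<Rightarrow> 'a pmf \<Rightarrow> 'a timed" where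
  "sample n p = Timed (map_pmf (\<lambda>x. (x, n)) p)"

definition bind_timed :: "'a timed \<Rightarrow> ('a \<Rightarrow> 'b timed) \<Rightarrow> 'b timed" where
  "bind_timed c f = Timed (bind_pmf (timed_pmf c) (\<lambda>(x, a).
     map_pmf (\<lambda>(y, b). (y, a + b)) (timed_pmf (f x))))"

adhoc_overloading Monad_Syntax.bind \<rightleftharpoons> bind_timed


section \<open>Public pricing\<close>

text \<open>The price \<open>\<infinity>\<close> plays the role of the reserve \<open>r (m + 1)\<close>.\<close>

definition price_ladder :: "nat \<Rightarrow> (nat \<Rightarrow> real) \<Rightarrow> bool" where
  "price_ladder m r \<longleftrightarrow> m \<ge> 1 \<and> r 0 = 0 \<and> (\<forall>j<m. r j < r (Suc j))"

definition qj :: "(nat \<Rightarrow> real) \<Rightarrow> nat \<Rightarrow> real" where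
  "qj r j = 1 - r (j - 1) / r j"

definition qtot :: "nat \<Rightarrow> (nat \<Rightarrow> real) \<Rightarrow> real" where
  "qtot m r = (\<Sum>j = 1..m. qj r j)"

definition valuation_dists :: "nat \<Rightarrow> (nat \<Rightarrow> real) \<Rightarrow> nat \<Rightarrow> (nat \<Rightarrow> real pmf) \<Rightarrow> bool" where
  "valuation_dists m r T v \<longleftrightarrow> (\<forall>t\<in>{1..T}. set_pmf (v t) \<subseteq> r ` {0..m})"

text \<open>
  The price is chosen from the internal state alone. Afterwards the algorithm is told the price it
  has posted, the distribution of the customer's valuation and whether a sale occurred; it never
  sees the valuation itself, nor the number of customers.
\<close>

record 's pricing_alg =
  start :: 's
  post_price :: "'s \<Rightarrow> ereal timed"
  observe :: "'s \<Rightarrow> ereal \<Rightarrow> real pmf \<Rightarrow> bool \<Rightarrow> 's timed"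

primrec play :: "'s pricing_alg \<Rightarrow> (real pmf \<times> real) list \<Rightarrow> 's \<Rightarrow> ereal list timed" where
  "play A [] s = ret []"
| "play A (x # xs) s = do {
     p \<leftarrow> post_price A s;
     s' \<leftarrow> observe A s p (fst x) (p \<le> ereal (snd x));
     ps \<leftarrow> play A xs s';
     ret (p # ps)
   }"

text \<open>Joint distribution of the valuations, the posted prices and the number of steps spent by the
  algorithm, where customer \<open>t\<close> has valuation \<open>V t\<close> and is offered price \<open>P t\<close>, \<open>1 \<le> t \<le> T\<close>.\<close>

definition execution ::
  "'s pricing_alg \<Rightarrow> nat \<Rightarrow> (nat \<Rightarrow> real pmf) \<Rightarrow> ((nat \<Rightarrow> real) \<times> (nat \<Rightarrow> ereal) \<times> nat) pmf" where
  "execution A T v =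
     bind_pmf (Pi_pmf {1..T} 0 v) (\<lambda>V.
       map_pmf (\<lambda>(ps, n). (V, (\<lambda>t. ps ! (t - 1)), n))
         (timed_pmf (play A (map (\<lambda>t. (v t, V t)) [1..<Suc T]) (start A))))"

definition revenue :: "nat \<Rightarrow> (nat \<Rightarrow> real) \<Rightarrow> (nat \<Rightarrow> ereal) \<Rightarrow> real" where
  "revenue T V P = (\<Sum>t = 1..T. if P t \<le> ereal (V t) then real_of_ereal (P t) else 0)"

definition opt :: "nat \<Rightarrow> nat \<Rightarrow> (nat \<Rightarrow> real) \<Rightarrow> real" where
  "opt k T V = sum_list (take (min k T) (rev (sort (map V [1..<Suc T]))))"

definition expected_alg :: "'s pricing_alg \<Rightarrow> nat \<Rightarrow> (nat \<Rightarrow> real pmf) \<Rightarrow> real" where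
  "expected_alg A T v = measure_pmf.expectation (execution A T v) (\<lambda>(V, P, n). revenue T V P)"

definition expected_opt :: "nat \<Rightarrow> nat \<Rightarrow> (nat \<Rightarrow> real pmf) \<Rightarrow> real" where
  "expected_opt k T v = measure_pmf.expectation (Pi_pmf {1..T} 0 v) (opt k T)"

definition public_pricing :: "nat \<Rightarrow> (nat \<Rightarrow> real) \<Rightarrow> nat \<Rightarrow> 's pricing_alg \<Rightarrow> bool" where
  "public_pricing m r k A \<longleftrightarrow>
     (\<forall>T v. valuation_dists m r T v \<longrightarrow>
       (\<forall>(V, P, n)\<in>set_pmf (execution A T v). \<forall>t\<in>{1..T}.
          P t \<in> insert \<infinity> ((\<lambda>j. ereal (r j)) ` {1..m}) \<and>
          (card {s\<in>{1..<t}. P s \<le> ereal (V s)} \<ge> k \<longrightarrow> P t = \<infinity>)))"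

definition competitive ::
  "nat \<Rightarrow> (nat \<Rightarrow> real) \<Rightarrow> nat \<Rightarrow> real \<Rightarrow> 's pricing_alg \<Rightarrow> bool" where
  "competitive m r k c A \<longleftrightarrow>
     public_pricing m r k A \<and>
     (\<forall>T\<ge>1. \<forall>v. valuation_dists m r T v \<longrightarrow> expected_alg A T v \<ge> c * expected_opt k T v)"


section \<open>Algorithm VT\<close>

text \<open>A state consists of the arrays \<open>level\<close> and \<open>sold\<close>, indexed by \<open>{1..k}\<close>.\<close>

type_synonym vt_state = "(nat \<Rightarrow> real) \<times> (nat \<Rightarrow> bool)"

definition vt_init :: vt_state where
  "vt_init = ((\<lambda>i. 0), (\<lambda>i. False))"

text \<open>A deterministic tie-breaking rule is a choice function on the sets of tied indices. It is
  charged as part of the pass over the levels.\<close>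

definition tie_breaking :: "nat \<Rightarrow> (nat set \<Rightarrow> nat) \<Rightarrow> bool" where
  "tie_breaking k tie \<longleftrightarrow> (\<forall>I\<subseteq>{1..k}. I \<noteq> {} \<longrightarrow> tie I \<in> I)"

definition vt_slot :: "nat \<Rightarrow> (nat set \<Rightarrow> nat) \<Rightarrow> (nat \<Rightarrow> real) \<Rightarrow> nat" where
  "vt_slot k tie level = tie {i\<in>{1..k}. \<forall>i'\<in>{1..k}. level i \<le> level i'}"

text \<open>Only meaningful for \<open>l < m\<close>. In reachable states of the algorithm an item of level \<open>r m\<close> has
  been sold, so the case \<open>l = m\<close> does not arise.\<close>

definition vt_index_pmf :: "nat \<Rightarrow> (nat \<Rightarrow> real) \<Rightarrow> nat \<Rightarrow> nat pmf" where
  "vt_index_pmf m r l =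
     embed_pmf (\<lambda>j. if j \<in> {l + 1..m} then qj r j / (\<Sum>j' = l + 1..m. qj r j') else 0)"

lemma price_ladder_mono: "price_ladder m r \<Longrightarrow> i < j \<Longrightarrow> j \<le> m \<Longrightarrow> r i < r j"
proof (induction j)
  case (Suc j)
  have s: "r j < r (Suc j)" using Suc.prems by (auto simp: price_ladder_def)
  show ?case using Suc.IH Suc.prems s by (cases "i = j") force+
qed simp

lemma qj_pos: assumes "price_ladder m r" "1 \<le> j" "j \<le> m" shows "qj r j > 0"
proof -
  have "r (j-1) < r j" "0 < r j" using price_ladder_mono[OF assms(1), of "j-1" j] price_ladder_mono[OF assms(1), of 0 j] assms
    by (auto simp: price_ladder_def)
  then show ?thesis by (simp add: qj_def field_simps)
qed

lemma pmf_vt_index_pmf: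
  assumes "price_ladder m r" "l < m"
  shows "pmf (vt_index_pmf m r l) j = (if j \<in> {l + 1..m} then qj r j / (\<Sum>j' = l + 1..m. qj r j') else 0)"
proof -
  have pos: "(\<Sum>j' = l + 1..m. qj r j') > 0"
    using assms by (intro sum_pos) (auto intro!: qj_pos)
  have nn: "0 \<le> (if j \<in> {l + 1..m} then qj r j / (\<Sum>j' = l + 1..m. qj r j') else 0)" for j
    using pos qj_pos[OF assms(1), of j] by (auto intro!: divide_nonneg_nonneg simp: less_imp_le)
  show ?thesis unfolding vt_index_pmf_def
  proof (rule pmf_embed_pmf)
    show "(\<integral>\<^sup>+ x. ennreal (if x \<in> {l + 1..m} then qj r x / (\<Sum>j' = l + 1..m. qj r j') else 0) \<partial>count_space UNIV) = 1"
      apply (subst nn_integral_count_space'[where A="{l+1..m}"])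
      using nn apply (auto)
      apply (subst sum_ennreal)
      using nn pos qj_pos[OF assms(1)] apply (force intro!: divide_nonneg_nonneg simp: less_imp_le)
      using pos by (simp add: sum_divide_distrib[symmetric])
  qed (use nn in auto)
qed

definition vt_price ::
  "nat \<Rightarrow> (nat \<Rightarrow> real) \<Rightarrow> nat \<Rightarrow> (nat set \<Rightarrow> nat) \<Rightarrow> vt_state \<Rightarrow> ereal timed" where
  "vt_price m r k tie = (\<lambda>(level, sold). do {
     tick (k + 1);
     let i = vt_slot k tie level;
     if sold i then ret \<infinity>
     else do {
       tick (m + 1);
       let l = (THE l. l \<le> m \<and> level i = r l);
       tick (4 * m);
       j \<leftarrow> sample m (vt_index_pmf m r l);
       ret (ereal (r j))
     }
   })"

definition vt_update :: "nat \<Rightarrow> (nat set \<Rightarrow> nat) \<Rightarrow> vt_state \<Rightarrow> real \<Rightarrow> bool \<Rightarrow> vt_state timed" where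
  "vt_update k tie = (\<lambda>(level, sold) V X. do {
     tick (k + 4);
     let i = vt_slot k tie level;
     ret (level(i := max (level i) V), if X then sold(i := True) else sold)
   })"

text \<open>Simulation of the algorithm on customers with the given valuation distributions; each
  distribution is a table of \<open>m + 1\<close> probabilities.\<close>

primrec vt_simulate ::
  "nat \<Rightarrow> (nat \<Rightarrow> real) \<Rightarrow> nat \<Rightarrow> (nat set \<Rightarrow> nat) \<Rightarrow> real pmf list \<Rightarrow> vt_state \<Rightarrow> vt_state timed" where
  "vt_simulate m r k tie [] s = do { tick 1; ret s }"
| "vt_simulate m r k tie (w # ws) s = do {
     tick 1;
     p \<leftarrow> vt_price m r k tie s;
     V \<leftarrow> sample (m + 1) w;
     tick 1;
     s' \<leftarrow> vt_update k tie s V (p \<le> ereal V);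
     vt_simulate m r k tie ws s'
   }"

definition vt_inventory :: "nat \<Rightarrow> vt_state \<Rightarrow> nat" where
  "vt_inventory k = (\<lambda>(level, sold). card {i\<in>{1..k}. \<not> sold i})"


section \<open>Algorithm Samp\<close>

primrec samp_attempts ::
  "nat \<Rightarrow> (nat \<Rightarrow> real) \<Rightarrow> nat \<Rightarrow> (nat set \<Rightarrow> nat) \<Rightarrow> real pmf list \<Rightarrow> nat \<Rightarrow> nat \<Rightarrow> ereal timed" where
  "samp_attempts m r k tie past b 0 = do { tick 1; ret \<infinity> }"
| "samp_attempts m r k tie past b (Suc n) = do {
     tick (1 + 2 * k);
     s \<leftarrow> vt_simulate m r k tie past vt_init;
     tick (k + 1);
     if vt_inventory k s = b then vt_price m r k tie s
     else samp_attempts m r k tie past b n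
   }"

text \<open>The state consists of the distributions of the past customers, in order of arrival, and the
  current inventory.\<close>

definition samp ::
  "nat \<Rightarrow> (nat \<Rightarrow> real) \<Rightarrow> nat \<Rightarrow> (nat set \<Rightarrow> nat) \<Rightarrow> nat \<Rightarrow> (real pmf list \<times> nat) pricing_alg" where
  "samp m r k tie C = \<lparr>
     start = ([], k),
     post_price = (\<lambda>(past, b). do {
       tick 5;
       let t = length past + 1;
       samp_attempts m r k tie past b (C * (k + 1) * t ^ 2)
     }),
     observe = (\<lambda>(past, b) p w X. do {
       tick (m + 3);
       ret (past @ [w], if X then b - 1 else b)
     })
   \<rparr>"

definition samp_C :: "real \<Rightarrow> nat" where
  "samp_C \<epsilon> = nat \<lceil>6 / (exp 1 * pi\<^sup>2 * \<epsilon>)\<rceil>"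

end

(*
  The levels in Algorithm VT do not depend on the posted prices: they form the k largest valuations
  seen so far. The price lottery keeps item i, given its level r(l), unsold with probability
  (q(l+1) + ... + q(m)) / q, so that raising its level from x to y yields expected revenue
  (y - x) / q. Hence VT earns exactly OPT / q in expectation.

  For Algorithm Samp, consider the idealized algorithm that at inventory b always posts the price of
  a simulated run of VT conditioned on having inventory b. Its inventory has the same distribution
  as that of VT, hence so does its revenue, and its expected revenue from any time onwards is at most
  E[OPT]. If VT has inventory b with probability x, then N attempts all fail with probability
  (1 - x)^N, and x (1 - x)^N <= 1 / (e N). Summing over inventories and customers bounds the total
  probability of a failure, and each failure costs at most E[OPT].
*)
theory Submission
  imports Defs
begin

text \<open>After a failed round the inventory of Samp no longer has the law of VT, so the matching
  probability at an inventory it visits may be tiny or 0. The law of Samp's inventory is therefore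
  never analysed. Both algorithms get a value function of the past distributions and the current
  inventory, and the positive part of the difference is averaged over the inventory of VT. On
  success Samp posts a price with the matched law, and such transitions, averaged over VT's
  inventory, give VT's inventory one customer later. A failure at inventory \<open>b\<close> enters
  with weight \<open>pr past b\<close>, which is the factor x in x (1 - x)^N.

  With k + 1 inventories and C (k + 1) t^2 attempts, customer t loses 1 / (e C t^2), in total pi^2 /
  (6 e C). The given C only ensures 6 / (e pi^2 C) <= epsilon. Hence the sharper weights
  \<open>failure_weight\<close>, whose sum stays below 6 / pi^2.\<close>

section \<open>Finite expectations\<close>

text \<open>On infinite supports this is \<open>0\<close>, which keeps it linear and monotone without integrability
  side conditions.\<close>

definition fexp :: "'a pmf \<Rightarrow> ('a \<Rightarrow> real) \<Rightarrow> real" where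
  "fexp p f = (\<Sum>x\<in>set_pmf p. pmf p x * f x)"

lemma fexp_eq_expectation: "finite (set_pmf p) \<Longrightarrow> measure_pmf.expectation p f = fexp p f"
  unfolding fexp_def by (subst integral_measure_pmf[of "set_pmf p"]) (auto)

lemma fexp_cong: "p = q \<Longrightarrow> (\<And>x. x \<in> set_pmf q \<Longrightarrow> f x = g x) \<Longrightarrow> fexp p f = fexp q g"
  by (auto simp: fexp_def)

lemma fexp_mono: "(\<And>x. x \<in> set_pmf p \<Longrightarrow> f x \<le> g x) \<Longrightarrow> fexp p f \<le> fexp p g"
  unfolding fexp_def by (auto intro!: sum_mono mult_left_mono)

lemma fexp_nonneg: "(\<And>x. x \<in> set_pmf p \<Longrightarrow> 0 \<le> f x) \<Longrightarrow> 0 \<le> fexp p f"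
  unfolding fexp_def by (auto intro!: sum_nonneg)

lemma fexp_add: "fexp p (\<lambda>x. f x + g x) = fexp p f + fexp p g"
  unfolding fexp_def by (simp add: sum.distrib algebra_simps)

lemma fexp_diff: "fexp p (\<lambda>x. f x - g x) = fexp p f - fexp p g"
  unfolding fexp_def by (simp add: sum_subtractf algebra_simps)

lemma fexp_cmult: "fexp p (\<lambda>x. c * f x) = c * fexp p f"
  unfolding fexp_def by (simp add: sum_distrib_left mult.left_commute)

lemma fexp_multc: "fexp p (\<lambda>x. f x * c) = fexp p f * c"
  unfolding fexp_def by (simp add: sum_distrib_right mult.assoc)

lemma fexp_divide: "fexp p (\<lambda>x. f x / c) = fexp p f / c"
  using fexp_multc[of p f "1 / c"] by simp

lemma fexp_zero [simp]: "fexp p (\<lambda>x. 0) = 0"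
  unfolding fexp_def by simp

lemma fexp_sum: "fexp p (\<lambda>x. \<Sum>i\<in>I. f i x) = (\<Sum>i\<in>I. fexp p (f i))"
  unfolding fexp_def by (simp add: sum_distrib_left sum.swap[of _ I])

lemma fexp_swap: "fexp p (\<lambda>x. fexp q (\<lambda>y. f x y)) = fexp q (\<lambda>y. fexp p (\<lambda>x. f x y))"
  unfolding fexp_def by (simp add: sum_distrib_left sum.swap[of _ "set_pmf p"] mult.left_commute)

lemma fexp_const: "finite (set_pmf p) \<Longrightarrow> fexp p (\<lambda>x. c) = c"
  by (simp add: fexp_eq_expectation[symmetric])

lemma fexp_le_const:
  "finite (set_pmf p) \<Longrightarrow> (\<And>x. x \<in> set_pmf p \<Longrightarrow> f x \<le> c) \<Longrightarrow> fexp p f \<le> c"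
  using fexp_mono[of p f "\<lambda>_. c"] by (simp add: fexp_const)

lemma fexp_return [simp]: "fexp (return_pmf x) f = f x"
  by (simp add: fexp_def)

lemma fexp_bind:
  assumes "finite (set_pmf p)" "\<And>x. x \<in> set_pmf p \<Longrightarrow> finite (set_pmf (g x))"
  shows "fexp (bind_pmf p g) f = fexp p (\<lambda>x. fexp (g x) f)"
proof -
  have "fexp (bind_pmf p g) f = measure_pmf.expectation (bind_pmf p g) f"
    using assms by (subst fexp_eq_expectation) auto
  also have "\<dots> = (\<Sum>a\<in>set_pmf p. pmf p a *\<^sub>R measure_pmf.expectation (g a) f)"
    using assms by (intro pmf_expectation_bind) auto
  also have "\<dots> = fexp p (\<lambda>x. fexp (g x) f)"
    unfolding fexp_def[of p] using assms by (auto intro!: sum.cong simp: fexp_eq_expectation)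
  finally show ?thesis .
qed

lemma fexp_map: "finite (set_pmf p) \<Longrightarrow> fexp (map_pmf g p) f = fexp p (\<lambda>x. f (g x))"
  unfolding map_pmf_def by (subst fexp_bind) auto

text \<open>The product distribution in list form, so that inductions can peel off the first or the
  last customer.\<close>

primrec draws :: "'a pmf list \<Rightarrow> 'a list pmf" where
  "draws [] = return_pmf []"
| "draws (w # ws) = bind_pmf w (\<lambda>x. map_pmf ((#) x) (draws ws))"

lemma finite_draws: "\<forall>w\<in>set ws. finite (set_pmf w) \<Longrightarrow> finite (set_pmf (draws ws))"
  by (induction ws) auto

lemma set_draws: "xs \<in> set_pmf (draws ws) \<Longrightarrow> list_all2 (\<lambda>x w. x \<in> set_pmf w) xs ws"
  by (induction ws arbitrary: xs) auto

lemma draws_snoc: "draws (ws @ [w]) = bind_pmf (draws ws) (\<lambda>xs. map_pmf (\<lambda>x. xs @ [x]) w)"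
  by (induction ws)
    (simp_all add: map_pmf_def bind_return_pmf bind_assoc_pmf)

lemma draws_map_conv_Pi_pmf:
  "distinct xs \<Longrightarrow> map_pmf (\<lambda>V. map V xs) (Pi_pmf (set xs) d v) = draws (map v xs)"
proof (induction xs)
  case (Cons x xs)
  have *: "map (f(x := y)) xs = map f xs" for f and y :: 'b
    using Cons.prems by auto
  show ?case
    using Cons
    by (simp add: Pi_pmf_insert' map_bind_pmf map_pmf_comp * o_def
        flip: Cons.IH map_pmf_def)
qed simp


section \<open>Results and costs of timed computations\<close>

definition val :: "'a timed \<Rightarrow> 'a pmf" where
  "val c = map_pmf fst (timed_pmf c)"

lemma val_ret [simp]: "val (ret x) = return_pmf x"
  by (simp add: val_def ret_def)

lemma val_tick [simp]: "val (tick n) = return_pmf ()"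
  by (simp add: val_def tick_def)

lemma val_sample [simp]: "val (sample n p) = p"
  by (simp add: val_def sample_def map_pmf_comp)

lemma val_bind [simp]: "val (bind_timed c f) = bind_pmf (val c) (\<lambda>x. val (f x))"
  by (simp add: val_def bind_timed_def map_bind_pmf bind_map_pmf map_pmf_comp case_prod_beta)

definition costs :: "'a timed \<Rightarrow> nat \<Rightarrow> bool" where
  "costs c n \<longleftrightarrow> (\<forall>(x, a)\<in>set_pmf (timed_pmf c). a \<le> n)"

lemma costs_mono: "costs c n \<Longrightarrow> n \<le> n' \<Longrightarrow> costs c n'"
  by (force simp: costs_def)

lemma costs_ret [simp]: "costs (ret x) n"
  by (simp add: costs_def ret_def)

lemma costs_tick [simp]: "costs (tick n) n"
  by (simp add: costs_def tick_def)

lemma costs_sample [simp]: "costs (sample n p) n"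
  by (auto simp: costs_def sample_def)

text \<open>Restricting \<open>x\<close> to the support lets the bound for the continuation use
  facts about the values reached, such as the length of the recorded past.\<close>

lemma costs_bind:
  assumes "costs c a" "\<And>x. x \<in> set_pmf (val c) \<Longrightarrow> costs (f x) b"
  shows "costs (bind_timed c f) (a + b)"
  using assms unfolding costs_def bind_timed_def val_def
  by (fastforce intro!: add_mono)


section \<open>Sums of largest elements\<close>

text \<open>A list shorter than \<open>b\<close> is summed entirely, which matches the
  \<open>min k T\<close> in \<open>opt\<close>.\<close>

definition topsum :: "nat \<Rightarrow> real list \<Rightarrow> real" where
  "topsum b xs = sum_list (take b (rev (sort xs)))"

text \<open>Insertion into a decreasing list; recursion on it replaces reasoning about
  \<open>rev (sort xs)\<close>.\<close>

primrec dinsert :: "real \<Rightarrow> real list \<Rightarrow> real list" where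
  "dinsert x [] = [x]"
| "dinsert x (y # ys) = (if x \<le> y then y # dinsert x ys else x # y # ys)"

lemma mset_dinsert [simp]: "mset (dinsert x ys) = add_mset x (mset ys)"
  by (induction ys) auto

lemma set_dinsert [simp]: "set (dinsert x ys) = insert x (set ys)"
  by (induction ys) auto

lemma sorted_wrt_dinsert: "sorted_wrt (\<ge>) ys \<Longrightarrow> sorted_wrt (\<ge>) (dinsert x ys)"
  by (induction ys) (fastforce)+

lemma rev_sort_eqI:
  assumes "mset xs = mset (ys::real list)" "sorted_wrt (\<ge>) ys"
  shows "rev (sort xs) = ys"
proof -
  have "sort xs = rev ys"
    using assms by (intro properties_for_sort) (auto simp: sorted_wrt_rev)
  then show ?thesis by simp
qed

lemma sorted_rev_sort: "sorted_wrt (\<ge>) (rev (sort (xs::real list)))"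
  by (simp add: sorted_wrt_rev)

lemma rev_sort_insert:
  assumes "mset xs = add_mset x (mset ys)"
  shows "rev (sort xs) = dinsert x (rev (sort ys))"
  using assms by (intro rev_sort_eqI) (auto intro!: sorted_wrt_dinsert sorted_rev_sort)

text \<open>If \<open>x\<close> lands among the first \<open>b + 1\<close> entries, both sides
  agree; otherwise the entry of \<open>ys\<close> at index \<open>b\<close> takes its place and is
  at least \<open>x\<close>.\<close>

lemma sum_take_dinsert_sell: "x + sum_list (take b ys) \<le> sum_list (take (Suc b) (dinsert x ys))"
proof (induction ys arbitrary: b)
  case (Cons y ys)
  show ?case using Cons[of "b - 1"] by (cases b) auto
qed simp

lemma sum_take_Suc_le:
  "0 \<le> x \<Longrightarrow> \<forall>y\<in>set ys. y \<le> (x::real) \<Longrightarrow> sum_list (take (Suc b) ys) \<le> x + sum_list (take b ys)"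
proof (induction ys arbitrary: b)
  case (Cons y ys)
  then show ?case by (cases b) auto
qed simp

lemma sum_take_dinsert_keep:
  "0 \<le> x \<Longrightarrow> sorted_wrt (\<ge>) ys \<Longrightarrow> sum_list (take b ys) \<le> sum_list (take b (dinsert x ys))"
proof (induction ys arbitrary: b)
  case (Cons y ys)
  show ?case
  proof (cases b)
    case (Suc b')
    show ?thesis
    proof (cases "x \<le> y")
      case False
      then have "sum_list (take (Suc b') (y # ys)) \<le> x + sum_list (take b' (y # ys))"
        using Cons.prems by (intro sum_take_Suc_le) auto
      then show ?thesis using Suc False by simp
    qed (use Cons Suc in simp)
  qed simp
qed (auto simp: take_Cons')

text \<open>Accounting for a sale: taking \<open>x\<close> now and the best \<open>b\<close> later
  cannot beat the best \<open>b + 1\<close> in hindsight.\<close>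

lemma topsum_Cons_sell: "x + topsum b xs \<le> topsum (Suc b) (x # xs)"
  unfolding topsum_def by (subst rev_sort_insert[of "x # xs" x xs]) (auto intro: sum_take_dinsert_sell)

lemma topsum_Cons_keep: "0 \<le> x \<Longrightarrow> topsum b xs \<le> topsum b (x # xs)"
  unfolding topsum_def
  by (subst rev_sort_insert[of "x # xs" x xs]) (auto intro!: sum_take_dinsert_keep sorted_rev_sort)

lemma topsum_nonneg: "\<forall>x\<in>set xs. 0 \<le> x \<Longrightarrow> 0 \<le> topsum b xs"
  unfolding topsum_def by (intro sum_list_nonneg) (auto dest!: in_set_takeD)

lemma topsum_mono:
  assumes "\<forall>x\<in>set xs. 0 \<le> x" "b \<le> c"
  shows "topsum b xs \<le> topsum c xs"
proof -
  have "take c (rev (sort xs)) = take b (rev (sort xs)) @ take (c - b) (drop b (rev (sort xs)))"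
    using assms(2) by (metis le_add_diff_inverse take_add)
  moreover have "0 \<le> sum_list (take (c - b) (drop b (rev (sort xs))))"
    using assms(1) by (intro sum_list_nonneg) (auto dest!: in_set_takeD in_set_dropD)
  ultimately show ?thesis by (simp add: topsum_def)
qed

text \<open>The padding stands for items still at level 0.\<close>

lemma topsum_padded:
  assumes "\<forall>x\<in>set xs. 0 \<le> x"
  shows "topsum b (xs @ replicate b 0) = topsum b xs"
proof -
  have "rev (sort (xs @ replicate b 0)) = rev (sort xs) @ replicate b 0"
    using assms by (intro rev_sort_eqI) (auto simp: sorted_wrt_append sorted_rev_sort sorted_wrt_iff_nth_less[of _ "replicate _ _"])
  then show ?thesis
    by (simp add: topsum_def sum_list_replicate)
qed

text \<open>This mirrors the level update of VT: among the \<open>b + 1\<close> largest entries only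
  the smallest, \<open>ys ! b\<close>, can be replaced. Adding it on the left avoids multiset
  subtraction.\<close>

lemma mset_take_dinsert:
  assumes "sorted_wrt (\<ge>) ys" "b < length ys"
  shows "add_mset (ys ! b) (mset (take (Suc b) (dinsert x ys)))
       = add_mset (max (ys ! b) x) (mset (take (Suc b) ys))"
  using assms
proof (induction ys arbitrary: b)
  case (Cons y ys)
  show ?case
  proof (cases "x \<le> y")
    case True
    then show ?thesis
      using Cons.IH[of "b - 1"] Cons.prems by (cases b) (auto simp: add_mset_commute max_def)
  next
    case False
    have "(y # ys) ! b \<in> set (y # ys)" using Cons.prems by (intro nth_mem)
    then have "(y # ys) ! b < x" using False Cons.prems(1) by auto
    moreover have "mset (take (Suc b) (y # ys)) = add_mset ((y # ys) ! b) (mset (take b (y # ys)))"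
      using Cons.prems(2) by (subst take_Suc_conv_app_nth) auto
    moreover have "dinsert x (y # ys) = x # y # ys" using False by simp
    ultimately show ?thesis by simp
  qed
qed simp


section \<open>Algorithm VT\<close>

definition sale_value :: "ereal \<Rightarrow> real \<Rightarrow> real" where
  "sale_value p V = (if p \<le> ereal V then real_of_ereal p else 0)"

locale vt =
  fixes m :: nat and r :: "nat \<Rightarrow> real" and k :: nat and tie :: "nat set \<Rightarrow> nat"
  assumes ladder: "price_ladder m r" and k_pos: "k \<ge> 1" and tie: "tie_breaking k tie"
begin

abbreviation slot :: "(nat \<Rightarrow> real) \<Rightarrow> nat" where
  "slot \<equiv> vt_slot k tie"

abbreviation q :: real where
  "q \<equiv> qtot m r"

definition prices :: "ereal set" where
  "prices = insert \<infinity> ((\<lambda>j. ereal (r j)) ` {1..m})"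

definition valid :: "real pmf \<Rightarrow> bool" where
  "valid w \<longleftrightarrow> set_pmf w \<subseteq> r ` {0..m}"

definition price :: "vt_state \<Rightarrow> ereal pmf" where
  "price s = val (vt_price m r k tie s)"

definition upd :: "vt_state \<Rightarrow> real \<Rightarrow> bool \<Rightarrow> vt_state" where
  "upd s V X = ((fst s)(slot (fst s) := max (fst s (slot (fst s))) V),
     if X then (snd s)(slot (fst s) := True) else snd s)"

definition step :: "real pmf \<Rightarrow> vt_state \<Rightarrow> vt_state pmf" where
  "step w s = bind_pmf (price s) (\<lambda>p. map_pmf (\<lambda>V. upd s V (p \<le> ereal V)) w)"

definition sim :: "real pmf list \<Rightarrow> vt_state pmf" where
  "sim ws = val (vt_simulate m r k tie ws vt_init)"

abbreviation inv :: "vt_state \<Rightarrow> nat" where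
  "inv \<equiv> vt_inventory k"

text \<open>The clause \<open>l < m\<close> for unsold items excludes the junk values of \<^const>\<open>vt_index_pmf\<close>.\<close>

definition good :: "vt_state \<Rightarrow> bool" where
  "good s \<longleftrightarrow> (\<forall>i\<in>{1..k}. \<exists>l\<le>m. fst s i = r l \<and> (snd s i \<or> l < m))"

section \<open>Ladder arithmetic, price lottery and reachable states of VT\<close>

lemma m_pos: "m \<ge> 1" and r_0 [simp]: "r 0 = 0"
  using ladder by (auto simp: price_ladder_def)

lemma r_less_iff: "i \<le> m \<Longrightarrow> j \<le> m \<Longrightarrow> r i < r j \<longleftrightarrow> i < j"
  using price_ladder_mono[OF ladder] by (metis linorder_neqE_nat order_less_asym)

lemma r_le_iff: "i \<le> m \<Longrightarrow> j \<le> m \<Longrightarrow> r i \<le> r j \<longleftrightarrow> i \<le> j"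
  using r_less_iff[of j i] by (meson linorder_not_less)

lemma r_eq_iff: "i \<le> m \<Longrightarrow> j \<le> m \<Longrightarrow> r i = r j \<longleftrightarrow> i = j"
  using r_le_iff[of i j] r_le_iff[of j i] by auto

lemma r_max: "i \<le> m \<Longrightarrow> j \<le> m \<Longrightarrow> max (r i) (r j) = r (max i j)"
  by (auto simp: max_def r_le_iff)

lemma r_nonneg: "j \<le> m \<Longrightarrow> 0 \<le> r j"
  using r_le_iff[of 0 j] by simp

lemma slot_in: "slot L \<in> {1..k}" and slot_le: "i \<in> {1..k} \<Longrightarrow> L (slot L) \<le> L i"
proof -
  let ?I = "{i \<in> {1..k}. \<forall>i'\<in>{1..k}. L i \<le> L i'}"
  have "Min (L ` {1..k}) \<in> L ` {1..k}"
    using k_pos by (intro Min_in) auto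
  then obtain i0 where "i0 \<in> {1..k}" "L i0 = Min (L ` {1..k})" by auto
  then have "i0 \<in> ?I" by simp
  then have "?I \<noteq> {}" by blast
  moreover have "?I \<subseteq> {1..k}" by blast
  ultimately have "tie ?I \<in> ?I"
    using tie unfolding tie_breaking_def by blast
  then have "slot L \<in> ?I"
    unfolding vt_slot_def .
  then show "slot L \<in> {1..k}" "i \<in> {1..k} \<Longrightarrow> L (slot L) \<le> L i"
    by auto
qed

lemma qj_positive: "1 \<le> j \<Longrightarrow> j \<le> m \<Longrightarrow> qj r j > 0"
  using qj_pos[OF ladder] .

lemma qj_times: "1 \<le> j \<Longrightarrow> j \<le> m \<Longrightarrow> qj r j * r j = r j - r (j - 1)"
  using r_less_iff[of 0 j] by (simp add: qj_def field_simps)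

lemma q_pos: "q > 0"
  unfolding qtot_def using m_pos by (intro sum_pos) (auto simp: qj_positive)

lemma set_vt_index_pmf: "l < m \<Longrightarrow> set_pmf (vt_index_pmf m r l) = {l + 1..m}"
proof -
  assume "l < m"
  then have "(\<Sum>j = l + 1..m. qj r j) > 0"
    by (intro sum_pos) (auto simp: qj_positive)
  then show ?thesis
    using \<open>l < m\<close> by (auto simp: set_pmf_eq pmf_vt_index_pmf[OF ladder] qj_positive less_imp_neq[symmetric]
        split: if_splits)
qed

lemma price_sold: "snd s (slot (fst s)) \<Longrightarrow> price s = return_pmf \<infinity>"
  by (simp add: price_def vt_price_def case_prod_beta Let_def bind_return_pmf)

lemma price_unsold:
  assumes "\<not> snd s (slot (fst s))" "fst s (slot (fst s)) = r l" "l \<le> m"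
  shows "price s = map_pmf (\<lambda>j. ereal (r j)) (vt_index_pmf m r l)"
proof -
  have "(THE l'. l' \<le> m \<and> r l = r l') = l"
    using assms(3) by (intro the_equality) (auto simp: r_eq_iff)
  then show ?thesis
    using assms by (simp add: price_def vt_price_def case_prod_beta Let_def bind_return_pmf map_pmf_def)
qed

lemma good_slotE:
  assumes "good s"
  obtains (sold) l where "snd s (slot (fst s))" "fst s (slot (fst s)) = r l" "l \<le> m"
          | (unsold) l where "\<not> snd s (slot (fst s))" "fst s (slot (fst s)) = r l" "l < m"
  using assms slot_in[of "fst s"] unfolding good_def by metis

lemma set_price: "good s \<Longrightarrow> set_pmf (price s) \<subseteq> prices"
  by (erule good_slotE) (auto simp: price_sold price_unsold set_vt_index_pmf prices_def)

lemma finite_price: "good s \<Longrightarrow> finite (set_pmf (price s))"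
  by (rule finite_subset[OF set_price]) (simp_all add: prices_def)

lemma val_price: "val (vt_price m r k tie s) = price s"
  by (simp add: price_def)

lemma val_update: "val (vt_update k tie s V X) = return_pmf (upd s V X)"
  by (simp add: vt_update_def case_prod_beta Let_def bind_return_pmf upd_def)

lemma val_simulate_append:
  "val (vt_simulate m r k tie (xs @ ys) s)
     = bind_pmf (val (vt_simulate m r k tie xs s)) (\<lambda>s. val (vt_simulate m r k tie ys s))"
  by (induction xs arbitrary: s) (simp_all add: bind_return_pmf bind_assoc_pmf)

lemma sim_Nil: "sim [] = return_pmf vt_init"
  by (simp add: sim_def bind_return_pmf)

text \<open>\<open>vt_simulate\<close> recurses from the first customer, whereas the arguments over
  time extend a given past by its last customer.\<close>

lemma sim_snoc: "sim (ws @ [w]) = bind_pmf (sim ws) (step w)"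
  by (simp add: sim_def val_simulate_append val_price val_update step_def[abs_def] map_pmf_def
      bind_return_pmf bind_return_pmf')

lemma valid_finite: "valid w \<Longrightarrow> finite (set_pmf w)"
  unfolding valid_def by (rule finite_subset) auto

lemma valid_cases: "valid w \<Longrightarrow> V \<in> set_pmf w \<Longrightarrow> (\<And>v. V = r v \<Longrightarrow> v \<le> m \<Longrightarrow> P) \<Longrightarrow> P"
  unfolding valid_def by auto

lemma valid_nonneg: "valid w \<Longrightarrow> V \<in> set_pmf w \<Longrightarrow> 0 \<le> V"
  by (erule valid_cases) (auto simp: r_nonneg)

lemma good_init: "good vt_init"
  using m_pos by (auto simp: good_def vt_init_def intro!: exI[of _ 0])

lemma price_le_top: "good s \<Longrightarrow> p \<in> set_pmf (price s) \<Longrightarrow> \<not> snd s (slot (fst s)) \<Longrightarrow> p \<le> ereal (r m)"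
  by (erule good_slotE) (auto simp: price_unsold set_vt_index_pmf r_le_iff)

text \<open>An unsold item can reach level \<open>r m\<close> only through a valuation
  \<open>r m\<close>. Every lottery price is at most that, so the item is sold at the same
  moment.\<close>

lemma good_upd:
  assumes s: "good s" and p: "p \<in> set_pmf (price s)" and v: "v \<le> m"
  shows "good (upd s (r v) (p \<le> ereal (r v)))"
  unfolding good_def
proof
  fix i assume i: "i \<in> {1..k}"
  show "\<exists>l\<le>m. fst (upd s (r v) (p \<le> ereal (r v))) i = r l \<and> (snd (upd s (r v) (p \<le> ereal (r v))) i \<or> l < m)"
  proof (cases "i = slot (fst s)")
    case True
    from s show ?thesis
    proof (cases rule: good_slotE)
      case (sold l)
      then show ?thesis
        using True v by (auto simp: upd_def r_max intro!: exI[of _ "max l v"])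
    next
      case (unsold l)
      then show ?thesis
        using True v price_le_top[OF s p]
        by (auto simp: upd_def r_max intro!: exI[of _ "max l v"]) (metis le_neq_implies_less)
    qed
  next
    case False
    then show ?thesis using s i by (auto simp: good_def upd_def)
  qed
qed

lemma good_sim: "\<forall>w\<in>set ws. valid w \<Longrightarrow> s \<in> set_pmf (sim ws) \<Longrightarrow> good s"
proof (induction ws arbitrary: s rule: rev_induct)
  case (snoc w ws)
  then show ?case
    by (auto simp: sim_snoc step_def intro!: good_upd elim!: valid_cases)
qed (simp add: sim_Nil good_init)

lemma finite_step: "good s \<Longrightarrow> valid w \<Longrightarrow> finite (set_pmf (step w s))"
  by (auto simp: step_def finite_price valid_finite)

lemma finite_sim: "\<forall>w\<in>set ws. valid w \<Longrightarrow> finite (set_pmf (sim ws))"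
  by (induction ws rule: rev_induct) (auto simp: sim_Nil sim_snoc intro!: finite_step good_sim)

lemma fexp_sim_snoc:
  assumes "\<forall>w\<in>set ws. valid w" "valid w"
  shows "fexp (sim (ws @ [w])) f
    = fexp (sim ws) (\<lambda>s. fexp (price s) (\<lambda>p. fexp w (\<lambda>V. f (upd s V (p \<le> ereal V)))))"
proof -
  have "fexp (sim (ws @ [w])) f = fexp (sim ws) (\<lambda>s. fexp (step w s) f)"
    using assms unfolding sim_snoc by (intro fexp_bind finite_sim finite_step good_sim) auto
  also have "\<dots> = fexp (sim ws) (\<lambda>s. fexp (price s) (\<lambda>p. fexp w (\<lambda>V. f (upd s V (p \<le> ereal V)))))"
    using assms good_sim[of ws]
    by (intro fexp_cong refl) (simp add: step_def fexp_bind fexp_map finite_price valid_finite)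
  finally show ?thesis .
qed


subsection \<open>Revenue\<close>

text \<open>The probability that an item of level \<open>x\<close> is unsold.\<close>

definition wt :: "real \<Rightarrow> real" where
  "wt x = (\<Sum>j | j \<in> {1..m} \<and> x < r j. qj r j) / q"

lemma wt_r: "l \<le> m \<Longrightarrow> wt (r l) = (\<Sum>j = l + 1..m. qj r j) / q"
  unfolding wt_def by (intro arg_cong2[of _ _ _ _ "(/)"] sum.cong) (auto simp: r_less_iff)

lemma wt_pos: "l < m \<Longrightarrow> wt (r l) > 0"
  using q_pos by (simp add: wt_r) (intro divide_pos_pos sum_pos; auto simp: qj_positive)

lemma wt_top: "wt (r m) = 0"
  by (simp add: wt_r)

text \<open>\<open>q * wt (r l)\<close> is the normalizing sum of the lottery.\<close>

lemma fexp_price_unsold: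
  assumes "\<not> snd s (slot (fst s))" "fst s (slot (fst s)) = r l" "l < m"
  shows "fexp (price s) f = (\<Sum>j = l + 1..m. qj r j * f (ereal (r j))) / (q * wt (r l))"
proof -
  have "fexp (price s) f = (\<Sum>j = l + 1..m. pmf (vt_index_pmf m r l) j * f (ereal (r j)))"
    using assms by (simp add: price_unsold fexp_map set_vt_index_pmf) (simp add: fexp_def set_vt_index_pmf)
  also have "\<dots> = (\<Sum>j = l + 1..m. qj r j * f (ereal (r j)) / (q * wt (r l)))"
    using q_pos assms(3) by (intro sum.cong) (auto simp: pmf_vt_index_pmf[OF ladder] wt_r)
  finally show ?thesis by (simp add: sum_divide_distrib)
qed

text \<open>The item survives iff its price exceeds \<open>r v\<close>. These prices are the ones
  above the new level, so the survival probability is a ratio of weights at the new and the old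
  level, and such ratios telescope over time.\<close>

lemma fexp_unsold_upd:
  assumes s: "good s" and v: "v \<le> m"
  shows "fexp (price s) (\<lambda>p. of_bool (\<not> snd (upd s (r v) (p \<le> ereal (r v))) i))
    = of_bool (\<not> snd s i) *
      (if i = slot (fst s) then wt (max (fst s i) (r v)) / wt (fst s i) else 1)"
proof (cases "i = slot (fst s)")
  case True
  from s show ?thesis
  proof (cases rule: good_slotE)
    case (sold l)
    then show ?thesis using True by (auto simp: upd_def price_sold)
  next
    case (unsold l)
    have "fexp (price s) (\<lambda>p. of_bool (\<not> snd (upd s (r v) (p \<le> ereal (r v))) i))
      = (\<Sum>j = l + 1..m. qj r j * of_bool (\<not> r j \<le> r v)) / (q * wt (r l))"
      using unsold True by (subst fexp_price_unsold[OF unsold]) (auto simp: upd_def)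
    also have "(\<Sum>j = l + 1..m. qj r j * of_bool (\<not> r j \<le> r v)) = (\<Sum>j = max l v + 1..m. qj r j)"
      using v by (intro sum.mono_neutral_cong_right) (auto simp: r_le_iff)
    also have "\<dots> / (q * wt (r l)) = wt (r (max l v)) / wt (r l)"
      using unsold(3) v by (subst wt_r[of "max l v"]) auto
    finally show ?thesis
      using unsold True v by (simp add: r_max)
  qed
next
  case False
  then have "snd (upd s V X) i = snd s i" for V X
    by (simp add: upd_def)
  then show ?thesis using s False by (simp add: fexp_const finite_price)
qed

text \<open>Here the choice of \<open>qj\<close> pays off: a price \<open>r j\<close> between the
  old level and \<open>r v\<close> contributes \<open>qj r j * r j = r j - r (j - 1)\<close>, and
  the sum telescopes to the rise of the level.\<close>

lemma fexp_sale_value: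
  assumes s: "good s" and v: "v \<le> m" and i: "i = slot (fst s)"
  shows "fexp (price s) (\<lambda>p. sale_value p (r v))
    = of_bool (\<not> snd s i) * ((max (fst s i) (r v) - fst s i) / (q * wt (fst s i)))"
  using s
proof (cases rule: good_slotE)
  case (sold l)
  then show ?thesis using i by (auto simp: price_sold sale_value_def)
next
  case (unsold l)
  have qt: "l < j \<Longrightarrow> j \<le> m \<Longrightarrow> qj r j * r j = r j - r (j - Suc 0)" for j
    using qj_times[of j] by simp
  have tele: "l \<le> n \<Longrightarrow> (\<Sum>j = l + 1..n. r j - r (j - 1)) = r n - r l" for n
    by (induction n rule: dec_induct) auto
  have "fexp (price s) (\<lambda>p. sale_value p (r v))
    = (\<Sum>j = l + 1..m. qj r j * (if r j \<le> r v then r j else 0)) / (q * wt (r l))"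
    by (subst fexp_price_unsold[OF unsold]) (simp add: sale_value_def cong: if_cong)
  also have "(\<Sum>j = l + 1..m. qj r j * (if r j \<le> r v then r j else 0)) = (\<Sum>j = l + 1..max l v. r j - r (j - 1))"
    using v unsold(3) by (intro sum.mono_neutral_cong_right) (auto simp: r_le_iff qt split: if_splits)
  also have "\<dots> = max (r l) (r v) - r l"
    using tele[of "max l v"] unsold(3) v by (simp add: r_max)
  finally show ?thesis using unsold i by simp
qed

text \<open>Cancelling \<open>wt\<close> is also sound at the top level \<open>r m\<close>, where it
  is 0 and division yields 0: the maximum is then \<open>r m\<close> as well, and both right-hand
  sides vanish.\<close>

lemma good_level_wt:
  assumes "good s" "v \<le> m" "i = slot (fst s)"
  shows "wt (max (fst s i) (r v)) / wt (fst s i) * wt (fst s i) = wt (max (fst s i) (r v))"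
    and "(max (fst s i) (r v) - fst s i) / (q * wt (fst s i)) * wt (fst s i) = (max (fst s i) (r v) - fst s i) / q"
proof -
  obtain l where l: "l \<le> m" "fst s i = r l"
    using good_slotE[OF assms(1)] assms(3) by (metis less_imp_le)
  have "wt (r l) = 0 \<Longrightarrow> l = m"
    using wt_pos[of l] l(1) by (cases "l = m") auto
  moreover have "max (r m) (r v) = r m"
    using assms(2) by (simp add: r_le_iff max_absorb1)
  ultimately show "wt (max (fst s i) (r v)) / wt (fst s i) * wt (fst s i) = wt (max (fst s i) (r v))"
    "(max (fst s i) (r v) - fst s i) / (q * wt (fst s i)) * wt (fst s i) = (max (fst s i) (r v) - fst s i) / q"
    using l q_pos by (cases "wt (r l) = 0"; auto simp: wt_top)+
qed

text \<open>The levels do not depend on the posted prices, so this says that, conditionally on the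
  levels, item \<open>i\<close> is unsold with probability \<open>wt (L i)\<close>.\<close>

lemma fexp_unsold:
  assumes "\<forall>w\<in>set ws. valid w" "i \<in> {1..k}"
  shows "fexp (sim ws) (\<lambda>s. g (fst s) * of_bool (\<not> snd s i)) = fexp (sim ws) (\<lambda>s. g (fst s) * wt (fst s i))"
  using assms
proof (induction ws arbitrary: g rule: rev_induct)
  case Nil
  have "wt 0 = 1" using wt_r[of 0] q_pos by (simp add: qtot_def)
  then show ?case by (simp add: sim_Nil vt_init_def)
next
  case (snoc w ws)
  define L' where "L' L V = L(slot L := max (L (slot L)) V)" for L and V :: real
  define c where "c L V = (if i = slot L then wt (max (L i) V) / wt (L i) else 1)" for L and V :: real
  have fst_upd: "fst (upd s V X) = L' (fst s) V" for s V X
    by (simp add: upd_def L'_def)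
  have valid: "\<forall>w\<in>set ws. valid w" "valid w" using snoc.prems by auto
  have "fexp (sim (ws @ [w])) (\<lambda>s. g (fst s) * of_bool (\<not> snd s i))
    = fexp (sim ws) (\<lambda>s. fexp w (\<lambda>V. g (L' (fst s) V)
        * fexp (price s) (\<lambda>p. of_bool (\<not> snd (upd s V (p \<le> ereal V)) i))))"
    using valid by (simp add: fexp_sim_snoc fst_upd fexp_swap[of "price _" w] fexp_cmult)
  also have "\<dots> = fexp (sim ws) (\<lambda>s. fexp w (\<lambda>V. g (L' (fst s) V) * (of_bool (\<not> snd s i) * c (fst s) V)))"
    using valid by (intro fexp_cong refl) (auto elim!: valid_cases simp: fexp_unsold_upd good_sim c_def)
  also have "\<dots> = fexp (sim ws) (\<lambda>s. fexp w (\<lambda>V. g (L' (fst s) V) * c (fst s) V) * of_bool (\<not> snd s i))"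
    unfolding fexp_multc[symmetric] by (simp add: mult.assoc mult.left_commute mult.commute)
  \<comment> \<open>The update by \<open>w\<close> and the ratio \<open>c\<close> are functions of
    the levels, so they are absorbed into the arbitrary \<open>g\<close> of the induction
    hypothesis.\<close>
  also have "\<dots> = fexp (sim ws) (\<lambda>s. fexp w (\<lambda>V. g (L' (fst s) V) * c (fst s) V) * wt (fst s i))"
    using snoc.prems by (intro snoc.IH) auto
  also have "\<dots> = fexp (sim ws) (\<lambda>s. fexp w (\<lambda>V. g (L' (fst s) V) * wt (L' (fst s) V i)))"
  proof (intro fexp_cong refl)
    fix s assume s: "s \<in> set_pmf (sim ws)"
    have "c (fst s) V * wt (fst s i) = wt (L' (fst s) V i)" if "V \<in> set_pmf w" for V
      using that valid good_level_wt(1)[OF good_sim[OF valid(1) s]]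
      by (auto simp: c_def L'_def elim!: valid_cases)
    then show "fexp w (\<lambda>V. g (L' (fst s) V) * c (fst s) V) * wt (fst s i) = fexp w (\<lambda>V. g (L' (fst s) V) * wt (L' (fst s) V i))"
      unfolding fexp_multc[symmetric] by (intro fexp_cong) (auto simp: mult.assoc)
  qed
  also have "\<dots> = fexp (sim (ws @ [w])) (\<lambda>s. g (fst s) * wt (fst s i))"
    using valid by (simp add: fexp_sim_snoc fst_upd)
      (intro fexp_cong refl, simp add: fexp_const finite_price good_sim)
  finally show ?case .
qed

text \<open>A potential for the revenue: each customer raises it by \<open>q\<close> times the
  expected payment.\<close>

definition levelsum :: "real pmf list \<Rightarrow> real" where
  "levelsum ws = fexp (sim ws) (\<lambda>s. \<Sum>i = 1..k. fst s i)"

lemma sum_fun_upd: "i \<in> {1..k} \<Longrightarrow> (\<Sum>j = 1..k. (f(i := y)) j) = (\<Sum>j = 1..k. f j) + y - (f i :: real)"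
  using sum.remove[of "{1..k}" i f] sum.remove[of "{1..k}" i "f(i := y)"] by simp

lemma VT_step_revenue:
  assumes valid: "\<forall>w\<in>set ws. valid w" "valid w"
  shows "fexp (sim ws) (\<lambda>s. fexp (price s) (\<lambda>p. fexp w (sale_value p)))
    = (levelsum (ws @ [w]) - levelsum ws) / q"
proof -
  define g where "g L = fexp w (\<lambda>V. (max (L (slot L)) V - L (slot L)) / (q * wt (L (slot L))))" for L
  define h where "h L = fexp w (\<lambda>V. max (L (slot L)) V - L (slot L))" for L
  have "fexp (sim ws) (\<lambda>s. fexp (price s) (\<lambda>p. fexp w (sale_value p)))
    = fexp (sim ws) (\<lambda>s. of_bool (\<not> snd s (slot (fst s))) * g (fst s))"
    unfolding g_def fexp_cmult[symmetric] fexp_swap[of "price _" w]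
    using valid by (intro fexp_cong refl) (auto elim!: valid_cases simp: fexp_sale_value good_sim)
  \<comment> \<open>\<open>fexp_unsold\<close> concerns a fixed item while the slot is random; the
    indicator of \<open>slot (fst s) = i\<close> depends on the levels only and reduces one to the
    other.\<close>
  also have "\<dots> = fexp (sim ws) (\<lambda>s. \<Sum>i = 1..k. (of_bool (slot (fst s) = i) * g (fst s)) * of_bool (\<not> snd s i))"
    using slot_in by (intro fexp_cong refl) (simp add: of_bool_def if_distrib[of "\<lambda>x. x * _"] sum.delta cong: if_cong)
  also have "\<dots> = fexp (sim ws) (\<lambda>s. \<Sum>i = 1..k. (of_bool (slot (fst s) = i) * g (fst s)) * wt (fst s i))"
    unfolding fexp_sum using valid by (intro sum.cong refl fexp_unsold)
  also have "\<dots> = fexp (sim ws) (\<lambda>s. g (fst s) * wt (fst s (slot (fst s))))"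
    using slot_in by (intro fexp_cong refl) (simp add: of_bool_def if_distrib[of "\<lambda>x. x * _"] sum.delta cong: if_cong)
  also have "\<dots> = fexp (sim ws) (\<lambda>s. h (fst s) / q)"
    unfolding g_def h_def fexp_multc[symmetric] fexp_divide[symmetric]
  proof (intro fexp_cong refl)
    fix s V assume s: "s \<in> set_pmf (sim ws)" and "V \<in> set_pmf w"
    then obtain v where v: "v \<le> m" "V = r v"
      using valid(2) by (auto elim: valid_cases)
    show "(max (fst s (slot (fst s))) V - fst s (slot (fst s))) / (q * wt (fst s (slot (fst s)))) * wt (fst s (slot (fst s)))
      = (max (fst s (slot (fst s))) V - fst s (slot (fst s))) / q"
      unfolding v(2) by (rule good_level_wt(2)[OF good_sim[OF valid(1) s] v(1) refl])
  qed
  also have "\<dots> = fexp (sim ws) (\<lambda>s. h (fst s)) / q"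
    by (rule fexp_divide)
  also have "fexp (sim ws) (\<lambda>s. h (fst s)) = levelsum (ws @ [w]) - levelsum ws"
    unfolding levelsum_def fexp_sim_snoc[OF valid] fexp_diff[symmetric]
  proof (intro fexp_cong refl)
    fix s assume s: "s \<in> set_pmf (sim ws)"
    have "fexp (price s) (\<lambda>p. fexp w (\<lambda>V. \<Sum>i = 1..k. fst (upd s V (p \<le> ereal V)) i))
      = fexp w (\<lambda>V. (\<Sum>i = 1..k. fst s i) + (max (fst s (slot (fst s))) V - fst s (slot (fst s))))"
      using s valid sum_fun_upd[OF slot_in, of "fst s" "fst s"]
      by (simp add: upd_def fexp_const finite_price good_sim add_diff_eq del: fun_upd_apply)
    also have "\<dots> = (\<Sum>i = 1..k. fst s i) + h (fst s)"
      unfolding fexp_add h_def using valid by (simp add: fexp_const valid_finite)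
    finally show "h (fst s) = fexp (price s) (\<lambda>p. fexp w (\<lambda>V. \<Sum>i = 1..k. fst (upd s V (p \<le> ereal V)) i)) - (\<Sum>i = 1..k. fst s i)"
      by simp
  qed
  finally show ?thesis .
qed

section \<open>Levels as the largest valuations\<close>

definition levels :: "real list \<Rightarrow> nat \<Rightarrow> real" where
  "levels = foldl (\<lambda>L V. L(slot L := max (L (slot L)) V)) (\<lambda>_. 0)"

lemma levels_snoc: "levels (xs @ [x]) = (levels xs)(slot (levels xs) := max (levels xs (slot (levels xs))) x)"
  by (simp add: levels_def)

text \<open>The posted price affects a step only through the sold flags, so it drops out of the
  first component.\<close>

lemma map_fst_sim: "map_pmf fst (sim ws) = map_pmf levels (draws ws)"
proof (induction ws rule: rev_induct)
  case (snoc w ws)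
  have "map_pmf fst (sim (ws @ [w])) = bind_pmf (map_pmf fst (sim ws))
      (\<lambda>L. map_pmf (\<lambda>V. L(slot L := max (L (slot L)) V)) w)"
    by (simp add: sim_snoc step_def map_bind_pmf bind_map_pmf map_pmf_comp upd_def)
  also have "\<dots> = map_pmf levels (draws (ws @ [w]))"
    unfolding snoc.IH by (simp add: draws_snoc map_bind_pmf bind_map_pmf map_pmf_comp levels_snoc)
  finally show ?case .
qed (simp add: sim_Nil vt_init_def levels_def)

lemma mset_levels:
  assumes "\<forall>x\<in>set xs. 0 \<le> x"
  shows "mset (map (levels xs) [1..<Suc k]) = mset (take k (rev (sort (xs @ replicate k 0))))"
  using assms
proof (induction xs rule: rev_induct)
  case Nil
  have "rev (sort (replicate k (0::real))) = replicate k 0"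
    by (intro rev_sort_eqI) (auto simp: sorted_wrt_iff_nth_less[of _ "replicate _ _"])
  then show ?case
    using map_replicate_const[of "0::real" "[1..<Suc k]"] by (simp add: levels_def del: upt_Suc)
next
  case (snoc x xs)
  define L where "L = levels xs"
  define ys where "ys = rev (sort (xs @ replicate k 0))"
  obtain b where b: "k = Suc b" using k_pos by (cases k) auto
  have srt: "sorted_wrt (\<ge>) ys" unfolding ys_def by (rule sorted_rev_sort)
  have len: "b < length ys" using b by (simp add: ys_def)
  have IH: "mset (map L [1..<Suc k]) = mset (take k ys)"
    using snoc by (simp add: L_def ys_def)
  \<comment> \<open>Since \<open>b = k - 1\<close>, the smallest of the \<open>k\<close> largest
    entries is the last one of \<open>take k ys\<close>.\<close>
  have min: "L (slot L) = ys ! b"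
  proof (rule antisym)
    have "ys ! b \<in># mset (take k ys)" using b len by (auto simp: in_set_conv_nth intro!: exI[of _ b])
    then show "L (slot L) \<le> ys ! b"
      unfolding IH[symmetric] by (auto intro!: slot_le)
    have "L (slot L) \<in># mset (map L [1..<Suc k])"
      using slot_in[of L] by (auto simp del: upt_Suc)
    then have "L (slot L) \<in> set (take k ys)" unfolding IH by simp
    then obtain n where "n < k" "n < length ys" "L (slot L) = ys ! n"
      by (auto simp: in_set_conv_nth)
    then show "ys ! b \<le> L (slot L)"
      using srt len b by (cases "n = b") (auto simp: sorted_wrt_iff_nth_less)
  qed
  \<comment> \<open>Adding the overwritten level back expresses the replacement of one entry as a
    multiset identity of the same shape as \<open>mset_take_dinsert\<close>.\<close>
  have "add_mset (L (slot L)) (mset (map (L(slot L := y)) [1..<Suc k])) = add_mset y (mset (map L [1..<Suc k]))" for y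
  proof -
    obtain us vs where uv: "[1..<Suc k] = us @ slot L # vs"
      using slot_in[of L] split_list[of "slot L" "[1..<Suc k]"] by (auto simp del: upt_Suc)
    have "distinct (us @ slot L # vs)" unfolding uv[symmetric] by simp
    then have "map (L(slot L := y)) us = map L us" "map (L(slot L := y)) vs = map L vs" by auto
    then show ?thesis
      unfolding uv map_append list.map mset_append by (simp add: add_mset_commute del: map_eq_conv mset_map)
  qed
  from this[of "max (ys ! b) x"]
  have "add_mset (ys ! b) (mset (map (levels (xs @ [x])) [1..<Suc k])) = add_mset (max (ys ! b) x) (mset (take k ys))"
    unfolding levels_snoc L_def[symmetric] IH min .
  also have "\<dots> = add_mset (ys ! b) (mset (take k (dinsert x ys)))"
    using mset_take_dinsert[OF srt len, of x] b by simp
  also have "dinsert x ys = rev (sort ((xs @ [x]) @ replicate k 0))"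
    unfolding ys_def by (rule rev_sort_insert[symmetric]) simp
  finally show ?case by simp
qed

lemma sum_levels: "\<forall>x\<in>set xs. 0 \<le> x \<Longrightarrow> (\<Sum>i = 1..k. levels xs i) = topsum k xs"
proof -
  assume nn: "\<forall>x\<in>set xs. 0 \<le> x"
  have "(\<Sum>i = 1..k. levels xs i) = sum_list (map (levels xs) [1..<Suc k])"
    by (subst sum_list_distinct_conv_sum_set) (auto intro!: sum.cong)
  also have "\<dots> = sum_mset (mset (map (levels xs) [1..<Suc k]))"
    by (rule sum_mset_sum_list[symmetric])
  also have "\<dots> = topsum k (xs @ replicate k 0)"
    unfolding mset_levels[OF nn] sum_mset_sum_list topsum_def ..
  finally show ?thesis using topsum_padded[OF nn] by simp
qed

lemma draws_nonneg:
  assumes "\<forall>w\<in>set ws. valid w" "xs \<in> set_pmf (draws ws)" "x \<in> set xs"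
  shows "0 \<le> x"
proof -
  have "list_all2 (\<lambda>x w. x \<in> set_pmf w) xs ws" using set_draws assms(2) .
  then have "\<exists>w\<in>set ws. x \<in> set_pmf w" using assms(3)
    by (metis in_set_conv_nth list_all2_conv_all_nth)
  then show ?thesis using assms(1) valid_nonneg by blast
qed

lemma finite_draws_valid: "\<forall>w\<in>set ws. valid w \<Longrightarrow> finite (set_pmf (draws ws))"
  by (intro finite_draws) (auto simp: valid_finite)

lemma levelsum_eq_topsum:
  assumes "\<forall>w\<in>set ws. valid w"
  shows "levelsum ws = fexp (draws ws) (topsum k)"
proof -
  have "levelsum ws = fexp (map_pmf fst (sim ws)) (\<lambda>L. \<Sum>i = 1..k. L i)"
    unfolding levelsum_def by (subst fexp_map) (auto intro!: finite_sim assms)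
  also have "\<dots> = fexp (draws ws) (\<lambda>xs. \<Sum>i = 1..k. levels xs i)"
    unfolding map_fst_sim by (subst fexp_map) (auto intro!: finite_draws_valid assms)
  also have "\<dots> = fexp (draws ws) (topsum k)"
    using assms by (intro fexp_cong refl sum_levels) (auto intro: draws_nonneg)
  finally show ?thesis .
qed

end


section \<open>Algorithm Samp\<close>

text \<open>\<open>(1 - x) ^ n\<close> is at most \<open>exp (- n * x)\<close>, and
  \<open>y * exp (- y)\<close> has its maximum \<open>1 / exp 1\<close> at \<open>y = 1\<close>;
  take \<open>y = n * x\<close>.\<close>

lemma one_minus_power_le:
  fixes x :: real
  assumes "0 \<le> x" "x \<le> 1" "n > 0"
  shows "x * (1 - x) ^ n \<le> 1 / (exp 1 * n)"
proof -
  have "n * x \<le> exp (n * x - 1)"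
    using exp_ge_add_one_self[of "n * x - 1"] by simp
  then have a: "n * x * exp 1 \<le> exp (n * x)"
    by (simp add: exp_diff field_simps)
  have "(1 - x) ^ n \<le> exp (- x) ^ n"
    using assms exp_ge_add_one_self[of "- x"] by (intro power_mono) auto
  also have "\<dots> = 1 / exp (n * x)"
    by (simp add: exp_of_nat_mult[symmetric] exp_minus field_simps)
  finally have "x * (1 - x) ^ n \<le> x / exp (n * x)"
    using assms mult_left_mono[of "(1 - x) ^ n" "1 / exp (n * x)" x] by simp
  also have "\<dots> \<le> 1 / (exp 1 * n)"
    using a assms by (simp add: field_simps)
  finally show ?thesis .
qed

text \<open>A plain bound \<open>1 / t\<^sup>2\<close> for every customer \<open>t\<close> would cost a factor \<open>(\<pi>\<^sup>2 / 6)\<^sup>2\<close> over the given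
  number of attempts. It is regained from the first two customers: the first simulation always
  matches, and before the second customer only two inventories are possible. Inventory \<open>0\<close> never
  matters, as nothing is lost there.\<close>

definition failure_weight :: "nat \<Rightarrow> real" where
  "failure_weight i = (if i = 0 then 0 else if i = 1 then 1 / 6 else 1 / (real i + 1)\<^sup>2)"

context vt
begin

definition attempts :: "real pmf list \<Rightarrow> nat \<Rightarrow> nat \<Rightarrow> ereal pmf" where
  "attempts past b n = val (samp_attempts m r k tie past b n)"

text \<open>\<open>pr\<close> is the probability that Algorithm VT has inventory \<open>b\<close> after the customers in \<open>past\<close>;
  \<open>on_match past b h / pr past b\<close> is the expectation of \<open>h\<close> of its next price given that inventory.\<close>

definition pr :: "real pmf list \<Rightarrow> nat \<Rightarrow> real" where
  "pr past b = fexp (sim past) (\<lambda>s. of_bool (inv s = b))"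

definition on_match :: "real pmf list \<Rightarrow> nat \<Rightarrow> (ereal \<Rightarrow> real) \<Rightarrow> real" where
  "on_match past b h = fexp (sim past) (\<lambda>s. of_bool (inv s = b) * fexp (price s) h)"

text \<open>At inventory 0 the posted price is \<open>\<infinity>\<close>, so the truncated
  \<open>b - 1\<close> never comes into effect there.\<close>

definition carry :: "real pmf \<Rightarrow> (nat \<Rightarrow> real) \<Rightarrow> nat \<Rightarrow> ereal \<Rightarrow> real" where
  "carry w f b p = fexp w (\<lambda>V. f (if p \<le> ereal V then b - 1 else b))"

definition gain :: "real pmf \<Rightarrow> (nat \<Rightarrow> real) \<Rightarrow> nat \<Rightarrow> ereal \<Rightarrow> real" where
  "gain w f b p = fexp w (sale_value p) + carry w f b p"

text \<open>Expected future revenue from inventory \<open>b\<close>: of the idealized algorithm that always posts the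
  price of a simulated run with matching inventory, and of Algorithm Samp.\<close>

primrec ideal :: "real pmf list \<Rightarrow> real pmf list \<Rightarrow> nat \<Rightarrow> real" where
  "ideal [] past b = 0"
| "ideal (w # ws) past b = on_match past b (gain w (ideal ws (past @ [w])) b) / pr past b"

primrec samp_value :: "nat \<Rightarrow> real pmf list \<Rightarrow> real pmf list \<Rightarrow> nat \<Rightarrow> real" where
  "samp_value C [] past b = 0"
| "samp_value C (w # ws) past b = fexp (attempts past b (C * (k + 1) * (length past + 1)\<^sup>2))
     (gain w (samp_value C ws (past @ [w])) b)"

text \<open>Taking the positive part allows the success probability in front of the future gap to be
  bounded by 1.\<close>

definition gap :: "nat \<Rightarrow> real pmf list \<Rightarrow> real pmf list \<Rightarrow> nat \<Rightarrow> real" where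
  "gap C ws past b = max 0 (ideal ws past b - samp_value C ws past b)"

section \<open>Repeated attempts and the inventory of simulated runs\<close>

lemma attempts_0: "attempts past b 0 = return_pmf \<infinity>"
  by (simp add: attempts_def bind_return_pmf)

lemma attempts_Suc:
  "attempts past b (Suc n) = bind_pmf (sim past) (\<lambda>s. if inv s = b then price s else attempts past b n)"
  by (simp add: attempts_def sim_def bind_return_pmf val_price if_distrib[of val] cong: if_cong)

lemma set_attempts: "\<forall>w\<in>set past. valid w \<Longrightarrow> set_pmf (attempts past b n) \<subseteq> prices"
  by (induction n) (auto simp: attempts_0 attempts_Suc prices_def split: if_splits
      dest!: good_sim set_price[THEN subsetD])

lemma finite_prices: "finite prices"
  by (simp add: prices_def)

lemma finite_attempts: "\<forall>w\<in>set past. valid w \<Longrightarrow> finite (set_pmf (attempts past b n))"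
  using set_attempts finite_prices by (rule finite_subset)

lemma inv_le: "inv s \<le> k"
proof -
  have "card {i \<in> {1..k}. \<not> snd s i} \<le> card {1..k}" by (intro card_mono) auto
  then show ?thesis by (simp add: vt_inventory_def case_prod_beta)
qed

lemma inv_init: "inv vt_init = k"
  by (simp add: vt_inventory_def vt_init_def del: atLeastAtMost_iff)

lemma inv_zero: "inv s = 0 \<Longrightarrow> snd s (slot (fst s))"
  using slot_in[of "fst s"] by (auto simp: vt_inventory_def case_prod_beta)

text \<open>This is why Samp respects its inventory: a run matched at inventory 0 has sold every
  item, and total failure posts \<open>\<infinity>\<close> as well.\<close>

lemma attempts_zero: "p \<in> set_pmf (attempts past 0 n) \<Longrightarrow> p = \<infinity>"
proof (induction n)
  case (Suc n)
  have "price s = return_pmf \<infinity>" if "inv s = 0" for s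
    using inv_zero[OF that] by (rule price_sold)
  then show ?case using Suc by (auto simp: attempts_Suc split: if_splits)
qed (simp add: attempts_0)

lemma price_sale:
  assumes "p \<in> set_pmf (price s)" "p \<le> ereal V"
  shows "\<not> snd s (slot (fst s))"
  using assms by (auto simp: price_sold)

text \<open>A sold slot is only ever priced at \<open>\<infinity>\<close>, so a sale always marks a
  fresh item.\<close>

lemma inv_upd:
  assumes "p \<in> set_pmf (price s)"
  shows "inv (upd s V (p \<le> ereal V)) = (if p \<le> ereal V then inv s - 1 else inv s)"
proof (cases "p \<le> ereal V")
  case True
  have "{i \<in> {1..k}. \<not> ((snd s)(slot (fst s) := True)) i} = {i \<in> {1..k}. \<not> snd s i} - {slot (fst s)}"
    by auto
  then show ?thesis
    using True price_sale[OF assms True] slot_in[of "fst s"]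
    by (simp add: vt_inventory_def case_prod_beta upd_def)
qed (simp add: vt_inventory_def case_prod_beta upd_def)

lemma sale_value_nonneg: "p \<in> prices \<Longrightarrow> 0 \<le> sale_value p V"
  by (auto simp: prices_def sale_value_def r_nonneg)

lemma carry_nonneg: "(\<And>b. 0 \<le> f b) \<Longrightarrow> 0 \<le> carry w f b p"
  unfolding carry_def by (intro fexp_nonneg)

lemma gain_nonneg: "p \<in> prices \<Longrightarrow> (\<And>b. 0 \<le> f b) \<Longrightarrow> 0 \<le> gain w f b p"
  unfolding gain_def by (intro add_nonneg_nonneg fexp_nonneg carry_nonneg sale_value_nonneg)

lemma pr_nonneg: "0 \<le> pr past b"
  unfolding pr_def by (intro fexp_nonneg) auto

lemma pr_le_1: "\<forall>w\<in>set past. valid w \<Longrightarrow> pr past b \<le> 1"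
  unfolding pr_def by (intro fexp_le_const finite_sim) auto

lemma pr_zeroD:
  assumes "\<forall>w\<in>set past. valid w" "pr past b = 0" "s \<in> set_pmf (sim past)"
  shows "inv s \<noteq> b"
proof
  assume "inv s = b"
  have "(\<Sum>s\<in>set_pmf (sim past). pmf (sim past) s * of_bool (inv s = b)) = 0"
    using assms(2) by (simp add: pr_def fexp_def)
  then have "pmf (sim past) s * of_bool (inv s = b) = 0"
    using assms finite_sim[of past] by (subst (asm) sum_nonneg_eq_0_iff) (auto simp del: of_bool_eq_0_iff)
  then show False using \<open>inv s = b\<close> assms(3) by (simp add: set_pmf_iff)
qed

lemma on_match_zero:
  assumes "\<forall>w\<in>set past. valid w" "pr past b = 0"
  shows "on_match past b h = 0"
proof -
  have "on_match past b h = fexp (sim past) (\<lambda>s. 0)"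
    unfolding on_match_def using pr_zeroD[OF assms] by (intro fexp_cong refl) auto
  then show ?thesis by simp
qed

text \<open>Unrolling the attempts gives a geometric series with ratio \<open>1 - pr past b\<close>;
  the nonnegative contribution of total failure is dropped. Multiplying by \<open>pr past b\<close>
  sums the series without a division.\<close>

lemma attempts_ge:
  assumes past: "\<forall>w\<in>set past. valid w" and h: "\<And>p. p \<in> prices \<Longrightarrow> 0 \<le> h p"
  shows "(1 - (1 - pr past b) ^ n) * on_match past b h \<le> pr past b * fexp (attempts past b n) h"
proof (induction n)
  case 0
  have "0 \<le> h \<infinity>" using h by (simp add: prices_def)
  then show ?case using pr_nonneg by (simp add: attempts_0)
next
  case (Suc n)
  let ?p = "pr past b" and ?N = "on_match past b h" and ?A = "fexp (attempts past b n) h"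
  have "fexp (attempts past b (Suc n)) h
    = fexp (sim past) (\<lambda>s. of_bool (inv s = b) * fexp (price s) h + (?A - of_bool (inv s = b) * ?A))"
    unfolding attempts_Suc using past
    by (subst fexp_bind) (auto simp: finite_sim finite_attempts finite_price good_sim intro!: fexp_cong)
  also have "\<dots> = ?N + (1 - ?p) * ?A"
    unfolding fexp_add fexp_diff fexp_multc on_match_def pr_def using past
    by (simp add: fexp_const finite_sim algebra_simps)
  finally have A: "fexp (attempts past b (Suc n)) h = ?N + (1 - ?p) * ?A" .
  have "?p * fexp (attempts past b (Suc n)) h = ?p * ?N + (1 - ?p) * (?p * ?A)"
    unfolding A by (simp add: algebra_simps)
  also have "\<dots> \<ge> ?p * ?N + (1 - ?p) * ((1 - (1 - ?p) ^ n) * ?N)"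
    using Suc pr_le_1[OF past, of b] by (intro add_left_mono mult_left_mono) auto
  finally show ?case by (simp add: algebra_simps)
qed

section \<open>Bounds on the value functions\<close>

lemma samp_value_nonneg: "\<forall>w\<in>set past \<union> set ws. valid w \<Longrightarrow> 0 \<le> samp_value C ws past b"
proof (induction ws arbitrary: past b)
  case (Cons w ws)
  have IH: "0 \<le> samp_value C ws (past @ [w]) b" for b
    using Cons.prems by (intro Cons.IH) auto
  have "set_pmf (attempts past b n) \<subseteq> prices" for n
    using Cons.prems by (intro set_attempts) auto
  then show ?case
    unfolding samp_value.simps by (intro fexp_nonneg gain_nonneg IH) blast
qed simp

text \<open>Hindsight dominates selling online: a sale earns at most \<open>V\<close> and uses up
  one unit, and a rejected customer only enlarges the list to choose from.\<close>

lemma ideal_le_topsum: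
  assumes "\<forall>w\<in>set past \<union> set ws. valid w"
  shows "ideal ws past b \<le> fexp (draws ws) (topsum b)"
  using assms
proof (induction ws arbitrary: past b)
  case Nil
  then show ?case by (simp add: topsum_def)
next
  case (Cons w ws)
  let ?c = "fexp (draws (w # ws)) (topsum b)" and ?g = "gain w (ideal ws (past @ [w])) b"
  have fin: "finite (set_pmf w)" "finite (set_pmf (draws ws))" "finite (set_pmf (sim past))"
    using Cons.prems by (auto intro: valid_finite finite_draws_valid finite_sim)
  have c: "?c = fexp w (\<lambda>V. fexp (draws ws) (\<lambda>xs. topsum b (V # xs)))"
    using fin by (simp add: fexp_bind fexp_map)
  have nn: "xs \<in> set_pmf (draws ws) \<Longrightarrow> \<forall>x\<in>set xs. 0 \<le> x" for xs
    using draws_nonneg[of ws xs] Cons.prems by auto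
  have "0 \<le> ?c"
    unfolding c using Cons.prems nn by (intro fexp_nonneg topsum_nonneg) (auto intro: valid_nonneg)
  have g: "?g p \<le> ?c" if s: "s \<in> set_pmf (sim past)" "inv s = b" and p: "p \<in> set_pmf (price s)" for s p
    unfolding c gain_def carry_def fexp_add[symmetric]
  proof (intro fexp_mono)
    fix V assume V: "V \<in> set_pmf w"
    show "sale_value p V + ideal ws (past @ [w]) (if p \<le> ereal V then b - 1 else b)
      \<le> fexp (draws ws) (\<lambda>xs. topsum b (V # xs))"
    proof (cases "p \<le> ereal V")
      case True
      \<comment> \<open>A sale requires an unsold slot, so a run with a sale has positive
        inventory.\<close>
      obtain b' where b': "b = Suc b'"
        using inv_zero[of s] price_sale[OF p True] s by (cases b) auto
      have "p \<in> prices"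
        using s(1) p Cons.prems set_price[OF good_sim[of past s]] by auto
      then have "sale_value p V \<le> V"
        using True by (auto simp: prices_def sale_value_def)
      moreover have "ideal ws (past @ [w]) b' \<le> fexp (draws ws) (topsum b')"
        using Cons.prems by (intro Cons.IH) auto
      ultimately have "sale_value p V + ideal ws (past @ [w]) b' \<le> fexp (draws ws) (\<lambda>xs. V + topsum b' xs)"
        using fin by (simp add: fexp_add fexp_const)
      also have "\<dots> \<le> fexp (draws ws) (\<lambda>xs. topsum b (V # xs))"
        unfolding b' by (intro fexp_mono topsum_Cons_sell)
      finally show ?thesis using True b' by simp
    next
      case False
      have "ideal ws (past @ [w]) b \<le> fexp (draws ws) (topsum b)"
        using Cons.prems by (intro Cons.IH) auto
      also have "\<dots> \<le> fexp (draws ws) (\<lambda>xs. topsum b (V # xs))"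
        using V Cons.prems by (intro fexp_mono topsum_Cons_keep) (auto intro: valid_nonneg)
      finally show ?thesis using False by (simp add: sale_value_def)
    qed
  qed
  have "on_match past b ?g \<le> fexp (sim past) (\<lambda>s. of_bool (inv s = b) * ?c)"
    unfolding on_match_def
  proof (intro fexp_mono)
    fix s assume s: "s \<in> set_pmf (sim past)"
    have "inv s = b \<Longrightarrow> fexp (price s) ?g \<le> ?c"
      using g[OF s] good_sim[OF _ s] Cons.prems by (intro fexp_le_const finite_price) auto
    then show "of_bool (inv s = b) * fexp (price s) ?g \<le> of_bool (inv s = b) * ?c"
      by (cases "inv s = b") simp_all
  qed
  also have "\<dots> = pr past b * ?c"
    unfolding pr_def fexp_multc ..
  \<comment> \<open>At an inventory that VT never has, \<open>ideal\<close> is 0 by division by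
    zero, and \<open>0 \<le> ?c\<close> suffices.\<close>
  finally show ?case
    using \<open>0 \<le> ?c\<close> pr_nonneg[of past b] by (cases "pr past b = 0") (auto simp: pos_divide_le_eq mult.commute)
qed

text \<open>Replaces the optimum over the remaining customers by the one over all customers, a bound
  that is the same at every time.\<close>

lemma topsum_append_draws:
  assumes "\<forall>w\<in>set past \<union> set ws. valid w"
  shows "fexp (draws ws) (topsum b) \<le> fexp (draws (past @ ws)) (topsum b)"
  using assms
proof (induction past)
  case (Cons w past)
  have fin: "finite (set_pmf w)" "finite (set_pmf (draws (past @ ws)))"
    using Cons.prems by (auto intro: valid_finite finite_draws_valid)
  have "fexp (draws ws) (topsum b) \<le> fexp w (\<lambda>V. fexp (draws (past @ ws)) (topsum b))"
    using Cons fin by (simp add: fexp_const)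
  also have "\<dots> \<le> fexp w (\<lambda>V. fexp (draws (past @ ws)) (\<lambda>xs. topsum b (V # xs)))"
    using Cons.prems by (intro fexp_mono topsum_Cons_keep) (auto intro: valid_nonneg)
  also have "\<dots> = fexp (draws ((w # past) @ ws)) (topsum b)"
    using fin by (simp add: fexp_bind fexp_map)
  finally show ?case .
qed simp

text \<open>The indicator is what confines \<open>failure\<close> to the inventories
  \<open>1..k\<close>.\<close>

lemma ideal_bound:
  assumes valid: "\<forall>w\<in>set past \<union> set ws. valid w" and b: "b \<le> k"
  shows "ideal ws past b \<le> of_bool (b \<noteq> 0) * fexp (draws (past @ ws)) (topsum k)"
proof (cases "b = 0")
  case True
  have "topsum 0 = (\<lambda>_. 0)" by (auto simp: topsum_def)
  then show ?thesis using ideal_le_topsum[OF valid, of 0] True by simp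
next
  case False
  have "ideal ws past b \<le> fexp (draws ws) (topsum b)"
    using valid by (rule ideal_le_topsum)
  also have "\<dots> \<le> fexp (draws ws) (topsum k)"
    using valid draws_nonneg[of ws] by (intro fexp_mono topsum_mono b) auto
  also have "\<dots> \<le> fexp (draws (past @ ws)) (topsum k)"
    using valid by (rule topsum_append_draws)
  finally show ?thesis using False by simp
qed

section \<open>Averaging over the inventory of VT\<close>

lemma sum_inventory: "(\<Sum>b\<le>k. of_bool (inv s = b) * F b) = (F (inv s) :: real)"
proof -
  have "(\<Sum>b\<le>k. of_bool (inv s = b) * F b) = (\<Sum>b\<in>{inv s}. of_bool (inv s = b) * F b)"
    using inv_le[of s] by (intro sum.mono_neutral_right) auto
  then show ?thesis by simp
qed

lemma fexp_inventory: "fexp (sim past) (\<lambda>s. F (inv s)) = (\<Sum>b\<le>k. pr past b * F b)"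
  unfolding sum_inventory[symmetric, of F] fexp_sum fexp_multc pr_def ..

text \<open>The tower rule for conditioning on the inventory: the weights \<open>pr past b\<close>
  cancel, and where such a weight is 0 so is \<open>on_match\<close>.\<close>

lemma fexp_on_match:
  assumes "\<forall>w\<in>set past. valid w"
  shows "fexp (sim past) (\<lambda>s. on_match past (inv s) (H (inv s)) / pr past (inv s))
    = fexp (sim past) (\<lambda>s. fexp (price s) (H (inv s)))"
proof -
  have "fexp (sim past) (\<lambda>s. on_match past (inv s) (H (inv s)) / pr past (inv s))
    = (\<Sum>b\<le>k. on_match past b (H b))"
    unfolding fexp_inventory[of past "\<lambda>b. on_match past b (H b) / pr past b"]
    using on_match_zero[OF assms] by (intro sum.cong) auto
  also have "\<dots> = fexp (sim past) (\<lambda>s. \<Sum>b\<le>k. of_bool (inv s = b) * fexp (price s) (H b))"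
    by (simp only: fexp_sum on_match_def)
  also have "\<dots> = fexp (sim past) (\<lambda>s. fexp (price s) (H (inv s)))"
    by (simp only: sum_inventory[of _ "\<lambda>b. fexp (price _) (H b)"])
  finally show ?thesis .
qed

text \<open>Under its own price VT's inventory moves as \<open>carry\<close> prescribes, so an
  average at one time becomes an average at the next.\<close>

lemma fexp_carry:
  assumes "\<forall>w\<in>set past. valid w" "valid w"
  shows "fexp (sim past) (\<lambda>s. fexp (price s) (carry w f (inv s))) = fexp (sim (past @ [w])) (\<lambda>s. f (inv s))"
proof -
  have "fexp (price s) (carry w f (inv s)) = fexp (price s) (\<lambda>p. fexp w (\<lambda>V. f (inv (upd s V (p \<le> ereal V)))))" for s
    by (intro fexp_cong refl) (simp add: carry_def inv_upd)
  then show ?thesis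
    by (simp only: fexp_sim_snoc[OF assms])
qed

lemma fexp_gain: "fexp p (gain w f b) = fexp p (\<lambda>x. fexp w (sale_value x)) + fexp p (carry w f b)"
proof -
  have "gain w f b = (\<lambda>x. fexp w (sale_value x) + carry w f b x)"
    by (simp add: gain_def fun_eq_iff)
  then show ?thesis by (simp only: fexp_add)
qed

lemma ideal_total:
  assumes "\<forall>w\<in>set past \<union> set ws. valid w"
  shows "fexp (sim past) (\<lambda>s. ideal ws past (inv s)) = (levelsum (past @ ws) - levelsum past) / q"
  using assms
proof (induction ws arbitrary: past)
  case (Cons w ws)
  have valid: "\<forall>w\<in>set past. valid w" "valid w" using Cons.prems by auto
  have "fexp (sim past) (\<lambda>s. ideal (w # ws) past (inv s))
    = fexp (sim past) (\<lambda>s. fexp (price s) (\<lambda>p. fexp w (sale_value p)))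
      + fexp (sim (past @ [w])) (\<lambda>s. ideal ws (past @ [w]) (inv s))"
    unfolding ideal.simps fexp_on_match[OF valid(1)] fexp_gain fexp_add fexp_carry[OF valid] ..
  also have "\<dots> = (levelsum (past @ [w]) - levelsum past) / q
      + (levelsum ((past @ [w]) @ ws) - levelsum (past @ [w])) / q"
    using Cons.prems Cons.IH[of "past @ [w]"] unfolding VT_step_revenue[OF valid] by simp
  finally show ?case by (simp add: diff_divide_distrib)
qed simp

section \<open>Loss of Samp against the idealized algorithm\<close>

lemma on_match_diff: "on_match past b (\<lambda>p. f p - g p) = on_match past b f - on_match past b g"
  by (simp add: on_match_def fexp_diff right_diff_distrib)

lemma on_match_mono:
  "(\<And>p. f p \<le> g p) \<Longrightarrow> on_match past b f \<le> on_match past b g"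
  unfolding on_match_def by (intro fexp_mono mult_left_mono) auto

text \<open>Let \<open>f\<close> be the probability that all attempts fail. The share
  \<open>1 - f\<close> of \<open>ideal\<close> is compared with the successful attempts and loses
  only what the next customer's gap carries; the share \<open>f\<close> is given up entirely, at a
  cost of at most \<open>f * M\<close>.\<close>

lemma gap_step:
  assumes valid: "\<forall>w\<in>set past \<union> set (w # ws). valid w" and p: "pr past b \<noteq> 0"
    and M: "ideal (w # ws) past b \<le> M" "0 \<le> M"
  shows "gap C (w # ws) past b \<le> on_match past b (carry w (gap C ws (past @ [w])) b) / pr past b
    + (1 - pr past b) ^ (C * (k + 1) * (length past + 1)\<^sup>2) * M"
proof -
  let ?p = "pr past b" and ?i = "ideal ws (past @ [w])" and ?s = "samp_value C ws (past @ [w])"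
    and ?g = "gap C ws (past @ [w])"
  define f where "f = (1 - ?p) ^ (C * (k + 1) * (length past + 1)\<^sup>2)"
  have p': "?p > 0" "?p \<le> 1" using p pr_nonneg[of past b] pr_le_1[of past b] valid by auto
  then have f: "0 \<le> f" "f \<le> 1" unfolding f_def by (auto intro!: power_le_one)
  have g: "0 \<le> on_match past b (carry w ?g b)"
    using on_match_mono[of "\<lambda>_. 0" "carry w ?g b"]
    by (simp add: on_match_def carry_nonneg gap_def)
  have "(1 - f) * on_match past b (gain w ?s b) \<le> ?p * samp_value C (w # ws) past b"
    unfolding f_def samp_value.simps using valid
    by (intro attempts_ge gain_nonneg samp_value_nonneg) auto
  then have s: "(1 - f) * (on_match past b (gain w ?s b) / ?p) \<le> samp_value C (w # ws) past b"
    using p' by (simp add: pos_divide_le_eq mult.commute)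
  have "on_match past b (gain w ?i b) - on_match past b (gain w ?s b)
    = on_match past b (\<lambda>p. carry w (\<lambda>b. ?i b - ?s b) b p)"
    unfolding on_match_diff[symmetric] by (simp add: gain_def carry_def fexp_diff)
  also have "\<dots> \<le> on_match past b (carry w ?g b)"
    unfolding carry_def gap_def by (intro on_match_mono fexp_mono) auto
  finally have d: "on_match past b (gain w ?i b) / ?p - on_match past b (gain w ?s b) / ?p
      \<le> on_match past b (carry w ?g b) / ?p"
    using p' by (simp add: diff_divide_distrib[symmetric] divide_right_mono)
  have "ideal (w # ws) past b - samp_value C (w # ws) past b
    \<le> ideal (w # ws) past b - (1 - f) * (on_match past b (gain w ?s b) / ?p)"
    using s by simp
  also have "\<dots> = (1 - f) * (ideal (w # ws) past b - on_match past b (gain w ?s b) / ?p)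
      + f * ideal (w # ws) past b"
    unfolding left_diff_distrib right_diff_distrib by simp
  also have "\<dots> \<le> (1 - f) * (on_match past b (carry w ?g b) / ?p) + f * M"
    using d M f by (intro add_mono mult_left_mono) simp_all
  also have "\<dots> \<le> on_match past b (carry w ?g b) / ?p + f * M"
    using f g p' by (intro add_right_mono mult_left_le_one_le) auto
  finally show ?thesis
    using g p' f M unfolding gap_def[of C "w # ws"] f_def[symmetric] by simp
qed

text \<open>The probability that all attempts for the next customer fail at a positive inventory, if
  that inventory has the law of VT.\<close>

definition failure :: "nat \<Rightarrow> real pmf list \<Rightarrow> real" where
  "failure C past = (\<Sum>b = 1..k. pr past b * (1 - pr past b) ^ (C * (k + 1) * (length past + 1)\<^sup>2))"

lemma gap_total_step:
  assumes valid: "\<forall>w\<in>set past \<union> set (w # ws). valid w"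
    and M: "M = fexp (draws (past @ w # ws)) (topsum k)"
  shows "fexp (sim past) (\<lambda>s. gap C (w # ws) past (inv s))
    \<le> fexp (sim (past @ [w])) (\<lambda>s. gap C ws (past @ [w]) (inv s)) + failure C past * M"
proof -
  let ?n = "C * (k + 1) * (length past + 1)\<^sup>2" and ?g = "gap C ws (past @ [w])"
  have M0: "0 \<le> M"
    unfolding M using valid draws_nonneg[of "past @ w # ws"] by (intro fexp_nonneg topsum_nonneg) auto
  have past: "\<forall>w\<in>set past. valid w" "valid w" using valid by auto
  have "fexp (sim past) (\<lambda>s. gap C (w # ws) past (inv s))
    \<le> fexp (sim past) (\<lambda>s. on_match past (inv s) (carry w ?g (inv s)) / pr past (inv s)
        + (1 - pr past (inv s)) ^ ?n * (of_bool (inv s \<noteq> 0) * M))"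
  proof (intro fexp_mono)
    fix s assume "s \<in> set_pmf (sim past)"
    then have "pr past (inv s) \<noteq> 0" using pr_zeroD[OF past(1), of "inv s" s] by auto
    then show "gap C (w # ws) past (inv s) \<le> on_match past (inv s) (carry w ?g (inv s)) / pr past (inv s)
        + (1 - pr past (inv s)) ^ ?n * (of_bool (inv s \<noteq> 0) * M)"
      using M0 ideal_bound[OF valid inv_le, of s] unfolding M[symmetric] by (intro gap_step valid) auto
  qed
  also have "\<dots> = fexp (sim (past @ [w])) (\<lambda>s. ?g (inv s))
      + fexp (sim past) (\<lambda>s. (1 - pr past (inv s)) ^ ?n * (of_bool (inv s \<noteq> 0) * M))"
    by (simp add: fexp_add fexp_on_match[OF past(1), of "carry w ?g"] fexp_carry[OF past])
  also have "fexp (sim past) (\<lambda>s. (1 - pr past (inv s)) ^ ?n * (of_bool (inv s \<noteq> 0) * M))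
    = (\<Sum>b\<le>k. pr past b * ((1 - pr past b) ^ ?n * (of_bool (b \<noteq> 0) * M)))"
    by (rule fexp_inventory)
  also have "\<dots> = (\<Sum>b = 1..k. pr past b * ((1 - pr past b) ^ ?n * (of_bool (b \<noteq> 0) * M)))"
    by (intro sum.mono_neutral_right) (auto simp: not_less_eq_eq)
  also have "\<dots> = failure C past * M"
    unfolding failure_def sum_distrib_right by (intro sum.cong) auto
  finally show ?thesis .
qed

lemma failure_le:
  assumes valid: "\<forall>w\<in>set past. valid w" and C: "C > 0"
  shows "failure C past \<le> failure_weight (length past) / (exp 1 * C)"
proof -
  let ?n = "C * (k + 1) * (length past + 1)\<^sup>2"
  have n: "?n > 0" using C by simp
  have term_le: "pr past b * (1 - pr past b) ^ ?n \<le> 1 / (exp 1 * ?n)" for b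
    using pr_nonneg pr_le_1[OF valid] n by (rule one_minus_power_le)
  consider "past = []" | w where "past = [w]" | "length past \<ge> 2"
    by (cases past; cases "tl past") auto
  then show ?thesis
  proof cases
    case 1
    then have "pr past b = of_bool (b = k)" for b
      by (simp add: pr_def sim_Nil inv_init eq_commute)
    \<comment> \<open>The term at \<open>b = k\<close> has the factor \<open>0 ^ ?n\<close> with
      \<open>?n > 0\<close>; in all other terms \<open>pr past b = 0\<close>.\<close>
    then have "failure C past = 0"
      unfolding failure_def using n by (intro sum.neutral) auto
    then show ?thesis using 1 by (simp add: failure_weight_def)
  next
    case (2 w)
    have w: "sim past = step w vt_init"
      using 2 sim_snoc[of "[]" w] by (simp add: sim_Nil bind_return_pmf)
    \<comment> \<open>The first customer buys at most one item. For \<open>k = 1\<close> the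
      intersection discards \<open>k - 1 = 0\<close>.\<close>
    let ?B = "{1..k} \<inter> {k - 1, k}"
    have "inv s \<in> {k - 1, k}" if "s \<in> set_pmf (sim past)" for s
      using that unfolding w step_def by (auto simp: inv_upd inv_init)
    then have "pr past b = fexp (sim past) (\<lambda>s. 0)" if "b \<notin> {k - 1, k}" for b
      unfolding pr_def using that by (intro fexp_cong refl) auto
    then have "failure C past = (\<Sum>b\<in>?B. pr past b * (1 - pr past b) ^ ?n)"
      unfolding failure_def by (intro sum.mono_neutral_right) auto
    also have "\<dots> \<le> card ?B * (1 / (exp 1 * ?n))"
      using term_le by (intro sum_bounded_above)
    \<comment> \<open>The minimum of 2 and \<open>k\<close> is at most
      \<open>2 * (k + 1) / 3\<close>, with equality at \<open>k = 2\<close>. Divided by the factor 4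
      of the second customer's attempts, this gives the weight \<open>1 / 6\<close>.\<close>
    also have "\<dots> \<le> (2 * real (k + 1) / 3) * (1 / (exp 1 * ?n))"
    proof (intro mult_right_mono)
      have "card ?B \<le> card {k - 1, k}"
        by (intro card_mono) auto
      then have "card ?B \<le> 2"
        by (auto simp: card_insert_if split: if_splits)
      moreover have "card ?B \<le> card {1..k}"
        by (intro card_mono) auto
      then have "card ?B \<le> k"
        by simp
      ultimately show "real (card ?B) \<le> 2 * real (k + 1) / 3" using k_pos by simp
    qed auto
    also have "\<dots> = (1 / 6) / (exp 1 * C)"
    proof -
      have "real ?n = real C * real (k + 1) * 4"
        using 2 by (simp only: of_nat_mult) simp
      then show ?thesis using C by (simp del: of_nat_mult of_nat_add of_nat_Suc)
    qed
    finally show ?thesis using 2 by (simp add: failure_weight_def)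
  next
    case 3
    have "failure C past \<le> card {1..k} * (1 / (exp 1 * ?n))"
      unfolding failure_def using term_le by (intro sum_bounded_above)
    also have "\<dots> \<le> (k + 1) * (1 / (exp 1 * ?n))"
      by (intro mult_right_mono) auto
    also have "\<dots> = (1 / (real (length past) + 1)\<^sup>2) / (exp 1 * C)"
    proof -
      have "real ?n = real C * real (k + 1) * (real (length past) + 1)\<^sup>2"
        by (simp only: of_nat_mult of_nat_power of_nat_add of_nat_1)
      then show ?thesis using C by (simp del: of_nat_mult of_nat_power of_nat_add of_nat_Suc)
    qed
    finally have "failure C past \<le> (1 / (real (length past) + 1)\<^sup>2) / (exp 1 * C)" .
    moreover have "past \<noteq> []" using 3 by auto
    ultimately show ?thesis using 3 by (simp add: failure_weight_def)
  qed
qed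

text \<open>\<open>past @ ws\<close> is unchanged when a customer moves from \<open>ws\<close> to
  \<open>past\<close>, so a single \<open>M\<close> serves the whole induction.\<close>

lemma gap_total:
  assumes "\<forall>w\<in>set past \<union> set ws. valid w" "C > 0"
    and "M = fexp (draws (past @ ws)) (topsum k)"
  shows "fexp (sim past) (\<lambda>s. gap C ws past (inv s))
    \<le> (\<Sum>i = length past..<length past + length ws. failure_weight i) / (exp 1 * C) * M"
  using assms
proof (induction ws arbitrary: past)
  case Nil
  then show ?case by (simp add: gap_def)
next
  case (Cons w ws)
  have M0: "0 \<le> M"
    unfolding Cons.prems(3) using Cons.prems(1) draws_nonneg[of "past @ w # ws"]
    by (intro fexp_nonneg topsum_nonneg) auto
  have "fexp (sim past) (\<lambda>s. gap C (w # ws) past (inv s))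
    \<le> fexp (sim (past @ [w])) (\<lambda>s. gap C ws (past @ [w]) (inv s)) + failure C past * M"
    using Cons.prems by (intro gap_total_step) auto
  also have "\<dots> \<le> (\<Sum>i = length (past @ [w])..<length (past @ [w]) + length ws. failure_weight i) / (exp 1 * C) * M
      + failure_weight (length past) / (exp 1 * C) * M"
    using Cons.prems M0 by (intro add_mono Cons.IH mult_right_mono failure_le) auto
  also have "\<dots> = (\<Sum>i = length past..<length past + length (w # ws). failure_weight i) / (exp 1 * C) * M"
    by (simp add: sum.atLeast_Suc_lessThan add_divide_distrib distrib_right)
  finally show ?case .
qed

end

lemma sum_inverse_squares_le: "(\<Sum>i = 2..<n. 1 / (real i + 1)\<^sup>2) \<le> 2 / 5"
proof -
  \<comment> \<open>With \<open>x = n + 1 / 2\<close> one has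
    \<open>x * (x + 1) = (n + 1) ^ 2 - 1 / 4\<close>, so each term is below the telescoping
    difference \<open>1 / x - 1 / (x + 1)\<close>. At \<open>n = 2\<close> the start
    \<open>1 / x\<close> equals \<open>2 / 5\<close>.\<close>
  have "n \<ge> 2 \<Longrightarrow> (\<Sum>i = 2..<n. 1 / (real i + 1)\<^sup>2) \<le> 2 / 5 - 1 / (real n + 1 / 2)"
  proof (induction n rule: dec_induct)
    case (step n)
    have "1 / (real n + 1)\<^sup>2 \<le> 1 / (real n + 1 / 2) - 1 / (real n + 3 / 2)"
      by (simp add: divide_simps power2_eq_square) (simp add: algebra_simps)
    then show ?case using step by (simp add: algebra_simps)
  qed simp
  moreover have "2 / 5 - 1 / (real n + 1 / 2) \<le> 2 / 5" by simp
  ultimately show ?thesis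
    by (cases "n \<ge> 2") (blast intro: order_trans, simp)
qed

text \<open>The Basel series with its tail from the third term on bounded by \<open>2 / 5\<close>;
  \<open>99 / 10\<close> is six times \<open>1 + 1 / 4 + 2 / 5\<close>.\<close>

lemma pi_square_less: "pi\<^sup>2 \<le> 99 / 10"
proof -
  have "(\<Sum>i<n. 1 / (real i + 1)\<^sup>2) \<le> 1 + 1 / 4 + 2 / 5" for n
  proof -
    have "(\<Sum>i<n. 1 / (real i + 1)\<^sup>2) \<le> (\<Sum>i<n + 2. 1 / (real i + 1)\<^sup>2)"
      by (intro sum_mono2) auto
    also have "\<dots> = (\<Sum>i<2. 1 / (real i + 1)\<^sup>2) + (\<Sum>i = 2..<n + 2. 1 / (real i + 1)\<^sup>2)"
      unfolding lessThan_atLeast0 by (rule sum.atLeastLessThan_concat[symmetric]) auto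
    finally show ?thesis
      using sum_inverse_squares_le[of "n + 2"] by (simp add: numeral_2_eq_2)
  qed
  then have "pi\<^sup>2 / 6 \<le> 1 + 1 / 4 + 2 / 5"
    using inverse_squares_sums unfolding sums_def by (intro LIMSEQ_le_const2) (auto simp: add.commute)
  then show ?thesis by simp
qed

lemma samp_C_pos: "\<epsilon> > 0 \<Longrightarrow> samp_C \<epsilon> > 0"
  by (simp add: samp_C_def)

lemma sum_failure_weight_le:
  assumes "\<epsilon> > 0"
  shows "(\<Sum>i<n. failure_weight i) / (exp 1 * samp_C \<epsilon>) \<le> \<epsilon>"
proof -
  \<comment> \<open>The two extra terms make the split at index 2 valid for \<open>n < 2\<close>
    too.\<close>
  have "(\<Sum>i<n. failure_weight i) \<le> (\<Sum>i<n + 2. failure_weight i)"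
    by (intro sum_mono2) (auto simp: failure_weight_def)
  also have "\<dots> = (\<Sum>i<2. failure_weight i) + (\<Sum>i = 2..<n + 2. failure_weight i)"
    unfolding lessThan_atLeast0 by (rule sum.atLeastLessThan_concat[symmetric]) auto
  also have "(\<Sum>i = 2..<n + 2. failure_weight i) = (\<Sum>i = 2..<n + 2. 1 / (real i + 1)\<^sup>2)"
    by (intro sum.cong) (auto simp: failure_weight_def)
  finally have "(\<Sum>i<n. failure_weight i) \<le> 1 / 6 + 2 / 5"
    using sum_inverse_squares_le[of "n + 2"] by (simp add: numeral_2_eq_2 failure_weight_def)
  \<comment> \<open>The left side is \<open>17 / 30\<close>, and \<open>6 / 9.9\<close> already
    exceeds 0.6.\<close>
  also have "\<dots> \<le> 6 / pi\<^sup>2"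
    using pi_square_less by (simp add: field_simps)
  also have "\<dots> \<le> \<epsilon> * (exp 1 * samp_C \<epsilon>)"
  proof -
    have "6 / (exp 1 * pi\<^sup>2 * \<epsilon>) \<le> samp_C \<epsilon>"
      unfolding samp_C_def by (rule real_nat_ceiling_ge)
    then show ?thesis using assms by (simp add: field_simps)
  qed
  finally show ?thesis
    using samp_C_pos[OF assms] by (simp add: pos_divide_le_eq)
qed


context vt
begin

section \<open>From executions to the value functions\<close>

abbreviation alg :: "nat \<Rightarrow> (real pmf list \<times> nat) pricing_alg" where
  "alg C \<equiv> samp m r k tie C"

lemma start_alg: "start (alg C) = ([], k)"
  by (simp add: samp_def)

lemma val_post_price: "val (post_price (alg C) (past, b)) = attempts past b (C * (k + 1) * (length past + 1)\<^sup>2)"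
  by (simp add: samp_def attempts_def bind_return_pmf Let_def)

lemma val_observe: "val (observe (alg C) (past, b) p w X) = return_pmf (past @ [w], if X then b - 1 else b)"
  by (simp add: samp_def bind_return_pmf)

lemma val_play_Cons:
  "val (play (alg C) ((w, V) # xs) (past, b))
    = bind_pmf (attempts past b (C * (k + 1) * (length past + 1)\<^sup>2)) (\<lambda>p.
        map_pmf ((#) p) (val (play (alg C) xs (past @ [w], if p \<le> ereal V then b - 1 else b))))"
  by (simp add: val_post_price val_observe bind_return_pmf map_pmf_def)

lemma finite_play:
  "length Vs = length ws \<Longrightarrow> \<forall>w\<in>set past \<union> set ws. valid w \<Longrightarrow>
    finite (set_pmf (val (play (alg C) (zip ws Vs) (past, b))))"
proof (induction Vs ws arbitrary: past b rule: list_induct2)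
  case (Cons V Vs w ws)
  have "finite (set_pmf (val (play (alg C) (zip ws Vs) (past @ [w], b'))))" for b'
    using Cons.prems by (intro Cons.IH) auto
  then show ?case
    using Cons.prems unfolding zip_Cons_Cons val_play_Cons by (auto simp: finite_attempts)
qed simp

text \<open>\<open>play\<close> runs with all valuations fixed in advance, while
  \<open>samp_value\<close> averages over each one on arrival. As a price is drawn before its
  valuation is used, the two orders can be exchanged.\<close>

lemma fexp_play:
  assumes "\<forall>w\<in>set past \<union> set ws. valid w"
  shows "fexp (draws ws) (\<lambda>Vs. fexp (val (play (alg C) (zip ws Vs) (past, b)))
      (\<lambda>ps. sum_list (map2 sale_value ps Vs))) = samp_value C ws past b"
  using assms
proof (induction ws arbitrary: past b)
  case (Cons w ws)
  let ?A = "attempts past b (C * (k + 1) * (length past + 1)\<^sup>2)"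
  let ?next = "\<lambda>p V. if p \<le> ereal V then b - 1 else b"
  let ?R = "\<lambda>ps Vs. sum_list (map2 sale_value ps Vs)"
  have fin: "finite (set_pmf w)" "finite (set_pmf (draws ws))" "finite (set_pmf ?A)"
    using Cons.prems by (auto intro!: valid_finite finite_draws_valid finite_attempts)
  have finp: "finite (set_pmf (val (play (alg C) (zip ws Vs) (past @ [w], b'))))"
    if "Vs \<in> set_pmf (draws ws)" for Vs b'
    using Cons.prems list_all2_lengthD[OF set_draws[OF that]] by (intro finite_play) auto
  have "fexp (draws (w # ws)) (\<lambda>Vs. fexp (val (play (alg C) (zip (w # ws) Vs) (past, b))) (\<lambda>ps. ?R ps Vs))
    = fexp w (\<lambda>V. fexp (draws ws) (\<lambda>Vs. fexp (val (play (alg C) ((w, V) # zip ws Vs) (past, b))) (\<lambda>ps. ?R ps (V # Vs))))"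
    using fin by (simp add: fexp_bind fexp_map)
  also have "\<dots> = fexp w (\<lambda>V. fexp (draws ws) (\<lambda>Vs. fexp ?A (\<lambda>p.
      sale_value p V + fexp (val (play (alg C) (zip ws Vs) (past @ [w], ?next p V))) (\<lambda>ps. ?R ps Vs))))"
    unfolding val_play_Cons using fin finp
    by (intro fexp_cong refl) (simp add: fexp_bind fexp_map fexp_add fexp_const)
  also have "\<dots> = fexp ?A (\<lambda>p. fexp w (\<lambda>V. fexp (draws ws) (\<lambda>Vs.
      sale_value p V + fexp (val (play (alg C) (zip ws Vs) (past @ [w], ?next p V))) (\<lambda>ps. ?R ps Vs))))"
    by (simp only: fexp_swap[of _ ?A])
  also have "\<dots> = fexp ?A (\<lambda>p. fexp w (\<lambda>V. sale_value p V + samp_value C ws (past @ [w]) (?next p V)))"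
    using Cons.prems fin by (simp add: fexp_add fexp_const Cons.IH)
  also have "\<dots> = samp_value C (w # ws) past b"
    by (simp add: gain_def[abs_def] carry_def fexp_add)
  finally show ?case .
qed simp

text \<open>The starting inventory \<open>b\<close> is arbitrary because each sale lowers it in the
  induction; the count of sales then shifts by one, until \<open>attempts_zero\<close>
  applies.\<close>

lemma play_prices:
  assumes "length Vs = length ws" "\<forall>w\<in>set past \<union> set ws. valid w"
    and "ps \<in> set_pmf (val (play (alg C) (zip ws Vs) (past, b)))"
  shows "length ps = length ws \<and> (\<forall>t<length ws. ps ! t \<in> prices \<and>
    (b \<le> card {s. s < t \<and> ps ! s \<le> ereal (Vs ! s)} \<longrightarrow> ps ! t = \<infinity>))"
  using assms
proof (induction Vs ws arbitrary: past b ps rule: list_induct2)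
  case (Cons V Vs w ws)
  define b' where "b' p = (if p \<le> ereal V then b - 1 else b)" for p
  obtain p qs where p: "p \<in> set_pmf (attempts past b (C * (k + 1) * (length past + 1)\<^sup>2))"
    and qs: "qs \<in> set_pmf (val (play (alg C) (zip ws Vs) (past @ [w], b' p)))" and ps: "ps = p # qs"
    using Cons.prems(2) unfolding zip_Cons_Cons val_play_Cons b'_def by auto
  have IH: "length qs = length ws \<and> (\<forall>t<length ws. qs ! t \<in> prices \<and>
    (b' p \<le> card {s. s < t \<and> qs ! s \<le> ereal (Vs ! s)} \<longrightarrow> qs ! t = \<infinity>))"
    using Cons.prems(1) qs by (intro Cons.IH) auto
  have "p \<in> prices"
    using p set_attempts[of past b] Cons.prems(1) by auto
  have card: "card {s. s < Suc t \<and> ps ! s \<le> ereal ((V # Vs) ! s)}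
    = of_bool (p \<le> ereal V) + card {s. s < t \<and> qs ! s \<le> ereal (Vs ! s)}" for t
  proof -
    have "{s. s < Suc t \<and> ps ! s \<le> ereal ((V # Vs) ! s)}
      = (if p \<le> ereal V then {0} else {}) \<union> Suc ` {s. s < t \<and> qs ! s \<le> ereal (Vs ! s)}"
      unfolding ps by (auto simp: less_Suc_eq_0_disj)
    then show ?thesis
      by (simp add: card_image)
  qed
  show ?case
  proof (intro conjI allI impI)
    show "length ps = length (w # ws)" using IH ps by simp
  next
    fix t assume t: "t < length (w # ws)"
    show "ps ! t \<in> prices"
      using t IH \<open>p \<in> prices\<close> unfolding ps by (cases t) auto
  next
    fix t assume t: "t < length (w # ws)" and b: "b \<le> card {s. s < t \<and> ps ! s \<le> ereal ((V # Vs) ! s)}"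
    show "ps ! t = \<infinity>"
    proof (cases t)
      case 0
      then show ?thesis using b p attempts_zero unfolding ps by simp
    next
      case (Suc t')
      then have "b' p \<le> card {s. s < t' \<and> qs ! s \<le> ereal (Vs ! s)}"
        using b unfolding Suc card b'_def by (auto split: if_splits)
      then show ?thesis using IH t Suc unfolding ps by simp
    qed
  qed
qed simp

lemma valid_dists: "valuation_dists m r T v \<Longrightarrow> \<forall>w\<in>set (map v [1..<Suc T]). valid w"
  by (auto simp: valuation_dists_def valid_def)

lemma play_input: "map (\<lambda>t. (v t, V t)) ts = zip (map v ts) (map V ts)"
  by (simp add: zip_map_map zip_same_conv_map)

lemma executionE:
  assumes "(V, P, n) \<in> set_pmf (execution (alg C) T v)"
  obtains ps where "(ps, n) \<in> set_pmf (timed_pmf (play (alg C) (zip (map v [1..<Suc T]) (map V [1..<Suc T])) ([], k)))"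
    and "P = (\<lambda>t. ps ! (t - 1))"
  using assms unfolding execution_def play_input start_alg by auto

lemma public_pricing_alg: "public_pricing m r k (alg C)"
  unfolding public_pricing_def
proof (intro allI impI ballI, clarify)
  fix T v V P n t
  assume v: "valuation_dists m r T v" and e: "(V, P, n) \<in> set_pmf (execution (alg C) T v)" and t: "t \<in> {1..T}"
  from e obtain ps where ps: "(ps, n) \<in> set_pmf (timed_pmf (play (alg C) (zip (map v [1..<Suc T]) (map V [1..<Suc T])) ([], k)))"
    and P: "P = (\<lambda>t. ps ! (t - 1))"
    by (rule executionE)
  have "ps \<in> set_pmf (val (play (alg C) (zip (map v [1..<Suc T]) (map V [1..<Suc T])) ([], k)))"
    using ps unfolding val_def by force
  from play_prices[OF _ _ this] have *: "\<forall>t<T. ps ! t \<in> prices \<and>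
    (k \<le> card {s. s < t \<and> ps ! s \<le> ereal (map V [1..<Suc T] ! s)} \<longrightarrow> ps ! t = \<infinity>)"
    using valid_dists[OF v] by simp
  \<comment> \<open>Customers are numbered from 1, list positions from 0.\<close>
  have "{s \<in> {1..<t}. P s \<le> ereal (V s)} = Suc ` {s. s < t - 1 \<and> ps ! s \<le> ereal (map V [1..<Suc T] ! s)}"
  proof (intro set_eqI iffI)
    fix s assume "s \<in> {s \<in> {1..<t}. P s \<le> ereal (V s)}"
    then show "s \<in> Suc ` {s. s < t - 1 \<and> ps ! s \<le> ereal (map V [1..<Suc T] ! s)}"
      using t unfolding P by (intro image_eqI[of _ _ "s - 1"]) (auto simp del: upt_Suc)
  qed (use t in \<open>auto simp: P simp del: upt_Suc\<close>)
  then have "card {s \<in> {1..<t}. P s \<le> ereal (V s)} = card {s. s < t - 1 \<and> ps ! s \<le> ereal (map V [1..<Suc T] ! s)}"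
    by (simp add: card_image)
  then show "P t \<in> insert \<infinity> ((\<lambda>j. ereal (r j)) ` {1..m}) \<and>
      (k \<le> card {s \<in> {1..<t}. P s \<le> ereal (V s)} \<longrightarrow> P t = \<infinity>)"
    using *[rule_format, of "t - 1"] t unfolding P prices_def by auto
qed

lemma expected_opt_eq: "valuation_dists m r T v \<Longrightarrow> expected_opt k T v = fexp (draws (map v [1..<Suc T])) (topsum k)"
proof -
  assume v: "valuation_dists m r T v"
  have "opt k T = (\<lambda>V. topsum k (map V [1..<Suc T]))"
    by (cases "k \<le> T") (simp_all add: fun_eq_iff opt_def topsum_def min_def del: upt_Suc)
  then have "expected_opt k T v = measure_pmf.expectation (map_pmf (\<lambda>V. map V [1..<Suc T]) (Pi_pmf (set [1..<Suc T]) 0 v)) (topsum k)"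
    by (simp add: expected_opt_def atLeastLessThanSuc_atLeastAtMost integral_map_pmf del: upt_Suc)
  also have "\<dots> = measure_pmf.expectation (draws (map v [1..<Suc T])) (topsum k)"
    by (subst draws_map_conv_Pi_pmf) simp_all
  finally show ?thesis
    using valid_dists[OF v] by (simp add: fexp_eq_expectation finite_draws_valid)
qed

lemma revenue_eq:
  assumes "length ps = T"
  shows "revenue T V (\<lambda>t. ps ! (t - 1)) = sum_list (map2 sale_value ps (map V [1..<Suc T]))"
proof -
  have "sum_list (map2 sale_value ps (map V [1..<Suc T])) = (\<Sum>i<T. sale_value (ps ! i) (V (Suc i)))"
    using assms by (simp add: sum_list_sum_nth lessThan_atLeast0 del: upt_Suc)
  also have "\<dots> = revenue T V (\<lambda>t. ps ! (t - 1))"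
    unfolding revenue_def by (rule sum.reindex_bij_witness[of _ "\<lambda>t. t - 1" Suc]) (auto simp: sale_value_def)
  finally show ?thesis ..
qed

lemma expected_alg_eq:
  assumes v: "valuation_dists m r T v"
  shows "expected_alg (alg C) T v = samp_value C (map v [1..<Suc T]) [] k"
proof -
  let ?ws = "map v [1..<Suc T]"
  let ?play = "\<lambda>Vs. play (alg C) (zip ?ws Vs) ([], k)"
  let ?R = "\<lambda>Vs ps. sum_list (map2 sale_value ps Vs)"
  have ws: "\<forall>w\<in>set ?ws. valid w" using valid_dists[OF v] .
  \<comment> \<open>Working with the law of the revenue discards the step count, so finiteness only
    concerns the valuations and the prices.\<close>
  have "map_pmf (\<lambda>(V, P, n). revenue T V P) (execution (alg C) T v)
    = bind_pmf (Pi_pmf {1..T} 0 v) (\<lambda>V. map_pmf (\<lambda>(ps, n). revenue T V (\<lambda>t. ps ! (t - 1))) (timed_pmf (?play (map V [1..<Suc T]))))"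
    unfolding execution_def play_input start_alg by (simp add: map_bind_pmf map_pmf_comp case_prod_unfold del: upt_Suc)
  also have "\<dots> = bind_pmf (Pi_pmf {1..T} 0 v) (\<lambda>V. map_pmf (?R (map V [1..<Suc T])) (val (?play (map V [1..<Suc T]))))"
  proof (intro bind_pmf_cong refl)
    fix V
    have "length (fst x) = T" if "x \<in> set_pmf (timed_pmf (?play (map V [1..<Suc T])))" for x
    proof -
      have "fst x \<in> set_pmf (val (?play (map V [1..<Suc T])))" using that by (simp add: val_def)
      from play_prices[OF _ _ this] show ?thesis using ws by simp
    qed
    then show "map_pmf (\<lambda>(ps, n). revenue T V (\<lambda>t. ps ! (t - 1))) (timed_pmf (?play (map V [1..<Suc T])))
      = map_pmf (?R (map V [1..<Suc T])) (val (?play (map V [1..<Suc T])))"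
      unfolding val_def map_pmf_comp by (intro map_pmf_cong refl) (simp add: case_prod_beta revenue_eq[unfolded One_nat_def] del: upt_Suc)
  qed
  also have "\<dots> = bind_pmf (map_pmf (\<lambda>V. map V [1..<Suc T]) (Pi_pmf (set [1..<Suc T]) 0 v)) (\<lambda>Vs. map_pmf (?R Vs) (val (?play Vs)))"
    by (simp add: bind_map_pmf atLeastLessThanSuc_atLeastAtMost del: upt_Suc)
  also have "\<dots> = bind_pmf (draws ?ws) (\<lambda>Vs. map_pmf (?R Vs) (val (?play Vs)))"
    by (subst draws_map_conv_Pi_pmf) simp_all
  finally have eq: "map_pmf (\<lambda>(V, P, n). revenue T V P) (execution (alg C) T v)
    = bind_pmf (draws ?ws) (\<lambda>Vs. map_pmf (?R Vs) (val (?play Vs)))" .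
  have fin: "finite (set_pmf (draws ?ws))" using ws by (rule finite_draws_valid)
  have finp: "finite (set_pmf (val (?play Vs)))" if "Vs \<in> set_pmf (draws ?ws)" for Vs
    using ws list_all2_lengthD[OF set_draws[OF that]] by (intro finite_play) auto
  have "expected_alg (alg C) T v = measure_pmf.expectation (bind_pmf (draws ?ws) (\<lambda>Vs. map_pmf (?R Vs) (val (?play Vs)))) (\<lambda>x. x)"
    unfolding expected_alg_def eq[symmetric] integral_map_pmf ..
  also have "\<dots> = fexp (draws ?ws) (\<lambda>Vs. fexp (map_pmf (?R Vs) (val (?play Vs))) (\<lambda>x. x))"
    using fin finp by (subst fexp_eq_expectation) (auto intro!: fexp_bind simp del: upt_Suc)
  also have "\<dots> = fexp (draws ?ws) (\<lambda>Vs. fexp (val (?play Vs)) (?R Vs))"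
    using finp by (intro fexp_cong refl) (simp add: fexp_map del: upt_Suc)
  also have "\<dots> = samp_value C ?ws [] k"
    using ws by (intro fexp_play) auto
  finally show ?thesis .
qed

lemma competitive_alg:
  assumes eps: "\<epsilon> > 0"
  shows "competitive m r k (1 / q - \<epsilon>) (alg (samp_C \<epsilon>))"
  unfolding competitive_def
proof (intro conjI allI impI public_pricing_alg)
  fix T :: nat and v assume v: "valuation_dists m r T v"
  let ?ws = "map v [1..<Suc T]" and ?C = "samp_C \<epsilon>"
  define M where "M = fexp (draws ?ws) (topsum k)"
  have ws: "\<forall>w\<in>set ?ws. valid w" using valid_dists[OF v] .
  have M0: "0 \<le> M"
    unfolding M_def using ws draws_nonneg by (intro fexp_nonneg topsum_nonneg) blast
  have "levelsum [] = 0"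
    by (simp add: levelsum_def sim_Nil vt_init_def)
  \<comment> \<open>Before the first customer the inventory \<open>k\<close> is certain, so the
    averaged statements become statements about the starting state.\<close>
  then have "ideal ?ws [] k = M / q"
    using ideal_total[of "[]" ?ws] ws levelsum_eq_topsum[OF ws] by (simp add: sim_Nil inv_init M_def del: upt_Suc)
  moreover have "gap ?C ?ws [] k \<le> (\<Sum>i<T. failure_weight i) / (exp 1 * ?C) * M"
    using gap_total[of "[]" ?ws ?C M] ws samp_C_pos[OF eps]
    by (simp add: sim_Nil inv_init M_def lessThan_atLeast0 del: upt_Suc)
  moreover have "\<dots> \<le> \<epsilon> * M"
    using sum_failure_weight_le[OF eps] M0 by (rule mult_right_mono)
  ultimately show "(1 / q - \<epsilon>) * expected_opt k T v \<le> expected_alg (alg ?C) T v"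
    unfolding expected_opt_eq[OF v] expected_alg_eq[OF v] M_def[symmetric] gap_def
    by (simp add: left_diff_distrib)
qed

end


section \<open>Running time\<close>

lemma costs_vt_price: "costs (vt_price m r k tie s) (k + 6 * m + 2)"
proof -
  obtain L S where s: "s = (L, S)" by (cases s)
  let ?i = "vt_slot k tie L"
  have "costs (bind_timed (tick (m + 1)) (\<lambda>_. bind_timed (tick (4 * m)) (\<lambda>_.
      bind_timed (sample m p) (\<lambda>j. ret (ereal (r j)))))) ((m + 1) + (4 * m + (m + 0)))" for p
    by (intro costs_bind costs_tick costs_sample costs_ret)
  then have "costs (if S ?i then ret \<infinity> else bind_timed (tick (m + 1)) (\<lambda>_. bind_timed (tick (4 * m)) (\<lambda>_.
      bind_timed (sample m (vt_index_pmf m r (THE l. l \<le> m \<and> L ?i = r l))) (\<lambda>j. ret (ereal (r j))))))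
      ((m + 1) + (4 * m + (m + 0)))"
    by (simp del: add_0_right)
  then have "costs (vt_price m r k tie s) ((k + 1) + ((m + 1) + (4 * m + (m + 0))))"
    unfolding s vt_price_def prod.case Let_def by (intro costs_bind costs_tick)
  then show ?thesis by (rule costs_mono) simp
qed

lemma costs_vt_update: "costs (vt_update k tie s V X) (k + 4)"
proof -
  have "costs (vt_update k tie s V X) ((k + 4) + 0)"
    unfolding vt_update_def case_prod_beta Let_def by (intro costs_bind costs_tick costs_ret)
  then show ?thesis by simp
qed

lemma costs_vt_simulate: "costs (vt_simulate m r k tie ws s) (length ws * (2 * k + 7 * m + 9) + 1)"
proof (induction ws arbitrary: s)
  case Nil
  have "costs (vt_simulate m r k tie [] s) (1 + 0)"
    unfolding vt_simulate.simps by (intro costs_bind costs_tick costs_ret)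
  then show ?case by simp
next
  case (Cons w ws)
  have "costs (vt_simulate m r k tie (w # ws) s) (1 + ((k + 6 * m + 2) + ((m + 1) + (1 + ((k + 4)
      + (length ws * (2 * k + 7 * m + 9) + 1))))))"
    unfolding vt_simulate.simps
    by (intro costs_bind costs_tick costs_sample costs_vt_price costs_vt_update Cons.IH)
  then show ?case by (rule costs_mono) simp
qed

text \<open>The summand outside the product pays for the lottery of the matching attempt, which
  occurs at most once, or for the final failure.\<close>

lemma costs_samp_attempts:
  "costs (samp_attempts m r k tie past b n)
    (n * (3 * k + 3 + length past * (2 * k + 7 * m + 9)) + (k + 6 * m + 2))"
proof (induction n)
  case 0
  have "costs (samp_attempts m r k tie past b 0) (1 + 0)"
    unfolding samp_attempts.simps by (intro costs_bind costs_tick costs_ret)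
  then show ?case by (rule costs_mono) simp
next
  case (Suc n)
  let ?c = "n * (3 * k + 3 + length past * (2 * k + 7 * m + 9)) + (k + 6 * m + 2)"
  have "costs (if vt_inventory k s = b then vt_price m r k tie s else samp_attempts m r k tie past b n) ?c" for s
    using Suc costs_mono[OF costs_vt_price] by simp
  then have "costs (samp_attempts m r k tie past b (Suc n))
      ((1 + 2 * k) + ((length past * (2 * k + 7 * m + 9) + 1) + ((k + 1) + ?c)))"
    unfolding samp_attempts.simps by (intro costs_bind costs_tick costs_vt_simulate)
  then show ?case by (rule costs_mono) simp
qed

lemma (in vt) costs_play:
  fixes T C :: nat
  defines "B \<equiv> 67 * C * k\<^sup>2 * T ^ 3 * m"
  assumes "C \<ge> 1" "length past + length xs \<le> T"
  shows "costs (play (alg C) xs (past, b)) (length xs * B)"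
  using assms(3)
proof (induction xs arbitrary: past b)
  case (Cons x xs)
  let ?t = "length past + 1"
  have t: "?t \<le> T" using Cons.prems by simp
  let ?att = "C * (k + 1) * ?t\<^sup>2 * (3 * k + 3 + length past * (2 * k + 7 * m + 9)) + (k + 6 * m + 2)"
  have post: "costs (post_price (alg C) (past, b)) (5 + ?att)"
    unfolding samp_def pricing_alg.simps prod.case Let_def by (intro costs_bind costs_tick costs_samp_attempts)
  have obs: "costs (observe (alg C) (past, b) p w X) ((m + 3) + 0)" for p w X
    unfolding samp_def pricing_alg.simps prod.case by (intro costs_bind costs_tick costs_ret)
  have rest: "costs (play (alg C) xs s') (length xs * B)"
    if "s' \<in> set_pmf (val (observe (alg C) (past, b) p w X))" for s' p w X
    using that Cons.prems by (auto simp: val_observe intro!: Cons.IH)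
  have "costs (play (alg C) (x # xs) (past, b)) ((5 + ?att) + (((m + 3) + 0) + (length xs * B + 0)))"
    unfolding play.simps by (intro costs_bind post obs rest costs_ret) auto
  \<comment> \<open>Since \<open>k\<close>, \<open>m\<close>, \<open>T\<close> and \<open>C\<close>
    are at least 1, lower-order terms are absorbed: the attempts cost at most 48 copies of
    \<open>C * k ^ 2 * T ^ 3 * m\<close> and the rest at most 18, within the 67 of
    \<open>B\<close>.\<close>
  moreover have "5 + ?att + (m + 3) \<le> B"
  proof -
    have T: "T \<ge> 1" using t by simp
    have mk: "1 \<le> k * m" "k \<le> k * m" "m \<le> k * m" using m_pos k_pos by auto
    have Tkm: "k * m \<le> T * (k * m)" using T by simp
    have "3 * k + 3 + length past * (2 * k + 7 * m + 9) \<le> 3 * k + 3 + T * (2 * k + 7 * m + 9)"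
      using t by (intro add_left_mono mult_right_mono) auto
    also have "\<dots> \<le> 6 * (k * m) + T * (18 * (k * m))"
      by (intro add_mono mult_left_mono) (use mk in linarith)+
    also have "\<dots> \<le> 24 * (T * (k * m))"
      using Tkm by simp
    finally have a: "3 * k + 3 + length past * (2 * k + 7 * m + 9) \<le> 24 * (T * (k * m))" .
    have "C * (k + 1) * ?t\<^sup>2 \<le> C * (2 * k) * T\<^sup>2"
      using t k_pos by (intro mult_mono power_mono) auto
    then have "C * (k + 1) * ?t\<^sup>2 * (3 * k + 3 + length past * (2 * k + 7 * m + 9))
      \<le> (C * (2 * k) * T\<^sup>2) * (24 * (T * (k * m)))"
      using a by (rule mult_mono) auto
    also have "\<dots> = 48 * (C * k\<^sup>2 * T ^ 3 * m)"
      by (simp add: power2_eq_square power3_eq_cube algebra_simps)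
    finally have att: "C * (k + 1) * ?t\<^sup>2 * (3 * k + 3 + length past * (2 * k + 7 * m + 9))
      \<le> 48 * (C * k\<^sup>2 * T ^ 3 * m)" .
    have "k * m \<le> (C * k * T ^ 3) * (k * m)"
      using assms(2) k_pos T by (simp add: Suc_le_eq)
    also have "\<dots> = C * k\<^sup>2 * T ^ 3 * m"
      by (simp add: power2_eq_square algebra_simps)
    finally have "k * m \<le> C * k\<^sup>2 * T ^ 3 * m" .
    moreover have "5 + (k + 6 * m + 2) + (m + 3) \<le> 18 * (k * m)"
      using mk by linarith
    ultimately have "5 + ?att + (m + 3) \<le> 67 * (C * k\<^sup>2 * T ^ 3 * m)"
      using att by linarith
    then show ?thesis
      unfolding B_def by (simp only: mult.assoc)
  qed
  ultimately show ?case
    by (elim costs_mono) simp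
qed simp

text \<open>\<open>exp 1 * pi ^ 2\<close> is at least 8, and the ceiling adds at most 1.\<close>

lemma samp_C_le: "\<epsilon> > 0 \<Longrightarrow> samp_C \<epsilon> \<le> 1 + 1 / \<epsilon>"
proof -
  assume eps: "\<epsilon> > 0"
  have "2 * 2\<^sup>2 \<le> exp 1 * pi\<^sup>2"
    using exp_ge_add_one_self[of 1] pi_ge_two by (intro mult_mono power_mono) auto
  then have "6 / (exp 1 * pi\<^sup>2 * \<epsilon>) \<le> 1 / \<epsilon>"
    using eps by (simp add: field_simps)
  moreover have "6 / (exp 1 * pi\<^sup>2 * \<epsilon>) \<ge> 0"
    using eps by simp
  ultimately show ?thesis
    unfolding samp_C_def by linarith
qed

text \<open>The coefficients of \<open>67 * (1 + x) * y ^ 2 * z ^ 4 * u\<close>; the fourth power of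
  \<open>T\<close> is \<open>T\<close> customers at cost of order \<open>T ^ 3\<close>. The tests
  are nested in the reverse order of the sums, so that these collapse from the inside.\<close>

definition time_coeff :: "nat \<Rightarrow> nat \<Rightarrow> nat \<Rightarrow> nat \<Rightarrow> real" where
  "time_coeff e1 e2 e3 e4 =
    (if e4 = 1 then if e3 = 4 then if e2 = 2 then if e1 \<le> 1 then 67 else 0 else 0 else 0 else 0)"

lemma sum_time_coeff:
  "(\<Sum>e1\<le>4. \<Sum>e2\<le>4. \<Sum>e3\<le>4. \<Sum>e4\<le>4. time_coeff e1 e2 e3 e4 * x ^ e1 * y ^ e2 * z ^ e3 * u ^ e4)
    = 67 * (1 + x) * y\<^sup>2 * z ^ 4 * u"
proof -
  have *: "(\<Sum>e\<le>4. (if e = c then f e else 0) * g e) = (if c \<le> 4 then f c * g c else 0)" for c :: nat and f g :: "nat \<Rightarrow> real"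
    by (simp add: if_distrib[of "\<lambda>x. x * _"] cong: if_cong)
  have "(\<Sum>e1\<le>4. \<Sum>e2\<le>4. \<Sum>e3\<le>4. \<Sum>e4\<le>4. time_coeff e1 e2 e3 e4 * x ^ e1 * y ^ e2 * z ^ e3 * u ^ e4)
    = (\<Sum>e1\<le>4. (if e1 \<le> 1 then 67 else 0) * x ^ e1 * y\<^sup>2 * z ^ 4 * u)"
    by (simp add: time_coeff_def mult.assoc *)
  also have "\<dots> = 67 * (1 + x) * y\<^sup>2 * z ^ 4 * u"
    by (simp add: eval_nat_numeral atMost_Suc algebra_simps)
  finally show ?thesis .
qed

lemma (in vt) running_time:
  assumes eps: "\<epsilon> > 0"
    and e: "(V, P, n) \<in> set_pmf (execution (alg (samp_C \<epsilon>)) T v)"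
  shows "real n \<le> 67 * (1 + 1 / \<epsilon>) * (real k)\<^sup>2 * real T ^ 4 * real m"
proof -
  from e obtain ps where ps: "(ps, n) \<in> set_pmf (timed_pmf (play (alg (samp_C \<epsilon>)) (zip (map v [1..<Suc T]) (map V [1..<Suc T])) ([], k)))"
    by (rule executionE)
  have "costs (play (alg (samp_C \<epsilon>)) (zip (map v [1..<Suc T]) (map V [1..<Suc T])) ([], k))
    (length (zip (map v [1..<Suc T]) (map V [1..<Suc T])) * (67 * samp_C \<epsilon> * k\<^sup>2 * T ^ 3 * m))"
    using samp_C_pos[OF eps] by (intro costs_play) auto
  then have "n \<le> T * (67 * samp_C \<epsilon> * k\<^sup>2 * T ^ 3 * m)"
    using ps unfolding costs_def by (auto simp del: upt_Suc)
  then have "real n \<le> real (T * (67 * samp_C \<epsilon> * k\<^sup>2 * T ^ 3 * m))"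
    by (rule of_nat_mono)
  also have "\<dots> = (67 * real (samp_C \<epsilon>)) * (real k)\<^sup>2 * real T ^ 4 * real m"
    by (simp add: power4_eq_xxxx power3_eq_cube)
  also have "\<dots> \<le> (67 * (1 + 1 / \<epsilon>)) * (real k)\<^sup>2 * real T ^ 4 * real m"
    using samp_C_le[OF eps] by (intro mult_right_mono) auto
  finally show ?thesis .
qed

theorem theorem5:
  shows "(\<forall>(m::nat) (r::nat \<Rightarrow> real) (k::nat) (tie::nat set \<Rightarrow> nat) (\<epsilon>::real).
            price_ladder m r \<and> k \<ge> 1 \<and> tie_breaking k tie \<and> \<epsilon> > 0 \<longrightarrow>
            competitive m r k (1 / qtot m r - \<epsilon>) (samp m r k tie (samp_C \<epsilon>)))
       \<and> (\<exists>(d::nat) (a::nat \<Rightarrow> nat \<Rightarrow> nat \<Rightarrow> nat \<Rightarrow> real).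
            \<forall>(m::nat) (r::nat \<Rightarrow> real) (k::nat) (tie::nat set \<Rightarrow> nat) (\<epsilon>::real)
             (T::nat) (v::nat \<Rightarrow> real pmf).
            price_ladder m r \<and> k \<ge> 1 \<and> tie_breaking k tie \<and> \<epsilon> > 0 \<and>
            T \<ge> 1 \<and> valuation_dists m r T v \<longrightarrow>
            (\<forall>(V, P, n)\<in>set_pmf (execution (samp m r k tie (samp_C \<epsilon>)) T v).
               real n \<le> (\<Sum>e1\<le>d. \<Sum>e2\<le>d. \<Sum>e3\<le>d. \<Sum>e4\<le>d.
                  a e1 e2 e3 e4 * (1 / \<epsilon>) ^ e1 * real k ^ e2 * real T ^ e3 * real m ^ e4)))"
proof (intro conjI exI[of _ 4] exI[of _ time_coeff] allI impI)
  fix m :: nat and r :: "nat \<Rightarrow> real" and k :: nat and tie :: "nat set \<Rightarrow> nat" and \<epsilon> :: real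
  assume "price_ladder m r \<and> k \<ge> 1 \<and> tie_breaking k tie \<and> \<epsilon> > 0"
  then show "competitive m r k (1 / qtot m r - \<epsilon>) (samp m r k tie (samp_C \<epsilon>))"
    by (intro vt.competitive_alg vt.intro) auto
next
  fix m :: nat and r :: "nat \<Rightarrow> real" and k :: nat and tie :: "nat set \<Rightarrow> nat" and \<epsilon> :: real
    and T :: nat and v :: "nat \<Rightarrow> real pmf"
  assume "price_ladder m r \<and> k \<ge> 1 \<and> tie_breaking k tie \<and> \<epsilon> > 0 \<and> T \<ge> 1 \<and> valuation_dists m r T v"
  then have "vt m r k tie" "\<epsilon> > 0" by (auto intro: vt.intro)
  then show "\<forall>(V, P, n)\<in>set_pmf (execution (samp m r k tie (samp_C \<epsilon>)) T v).
    real n \<le> (\<Sum>e1\<le>4. \<Sum>e2\<le>4. \<Sum>e3\<le>4. \<Sum>e4\<le>4.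
      time_coeff e1 e2 e3 e4 * (1 / \<epsilon>) ^ e1 * real k ^ e2 * real T ^ e3 * real m ^ e4)"
    unfolding sum_time_coeff using vt.running_time by blast
qed

end
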